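(* Let $k$ be a fixed positive integer. Then, for almost all positive integers $n$, simultaneously for all integers $0\le j<k$, $$\frac{T^{(j+1)}(n)}{T^{(j)}(n)}\ge(1-o(1))\frac{T(n)}{n},$$ where the $o(1)$ term may depend on $k$ and is uniform in $0\le j<k$. That is, there exist a set $A$ of positive integers of asymptotic density $1$ and a function $\xi:A\to\mathbb{R}$ (both possibly depending on $k$) with $\xi(n)\to0$ as $n\to\infty$ through $A$, such that for every $n\in A$ and every $0\le j<k$ the ratio $\frac{T^{(j+1)}(n)}{T^{(j)}(n)}$ is defined and is at least $(1-\xi(n))\frac{T(n)}{n}$. Consequently, for every fixed positive integer $j$, $$T^{(j)}(n)\ge(1-o(1))\,n\left(\frac{T(n)}{n}\right)^j$$ for almost all positive integers $n$ (i.e. there exist a set $A_j$ of asymptotic density $1$ and a function $\xi_j$ with $\xi_j(n)\to0$ as $n\to\infty$ through $A_j$, such that $T^{(j)}(n)$ is defined and $T^{(j)}(n)\ge(1-\xi_j(n))\,n\,(T(n)/n)^j$ for all $n\in A_j$).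
   Context: The Dedekind psi function is $\psi(n)=n\prod_{p\mid n}\left(1+\frac1p\right)$ for positive integers $n$ (product over primes $p$ dividing $n$), and $T(n):=\psi(n)-n$. Put $T^{(0)}(n)=n$ and $T^{(j+1)}(n)=T\bigl(T^{(j)}(n)\bigr)$ whenever $T^{(j)}(n)$ is a positive integer (note $T(1)=0$, so an orbit may terminate at $0$). Integers $n$ for which a relevant iterate is undefined or the denominator of a ratio is zero are regarded as belonging to the exceptional set. The asymptotic density of a set $A$ of positive integers is $d(A)=\lim_{x\to\infty}\frac1x\#\{n\le x:n\in A\}$ when the limit exists. "For almost all positive integers" means outside a set of asymptotic density $0$. *)

theory Defs
  imports Complex_Main "HOL-Computational_Algebra.Primes"
begin

definition dedekind_psi :: "nat \<Rightarrow> real" where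
  "dedekind_psi n = real n * (\<Prod>p\<in>prime_factors n. 1 + 1 / real p)"

text \<open>
  The value \<open>\<psi>(n) - n\<close> is always a natural number, so the floor only changes the type;
  see \<open>real_dedekind_T\<close>. At the junk argument \<open>0\<close> the value is \<open>0\<close>.
\<close>

definition dedekind_T :: "nat \<Rightarrow> nat" where
  "dedekind_T n = nat \<lfloor>dedekind_psi n - real n\<rfloor>"

lemma real_dedekind_T: "real (dedekind_T n) = dedekind_psi n - real n"
proof (cases "n = 0")
  case True
  then show ?thesis by (simp add: dedekind_T_def dedekind_psi_def)
next
  case False
  let ?P = "prime_factors n"
  have pos: "p > 0" if "p \<in> ?P" for p
    using that by (auto simp: in_prime_factors_iff prime_gt_0_nat)
  have "\<Prod>?P dvd (\<Prod>p\<in>?P. p ^ multiplicity p n)"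
  proof (rule prod_dvd_prod)
    fix p assume "p \<in> ?P"
    then have "multiplicity p n > 0"
      by (simp add: prime_factors_multiplicity)
    then show "p dvd p ^ multiplicity p n" by (simp add: dvd_power)
  qed
  also have "(\<Prod>p\<in>?P. p ^ multiplicity p n) = n"
    using False by (simp add: prod_prime_factors)
  finally obtain m where m: "n = \<Prod>?P * m" by (elim dvdE)
  have "dedekind_psi n = real m * ((\<Prod>p\<in>?P. real p) * (\<Prod>p\<in>?P. 1 + 1 / real p))"
    unfolding dedekind_psi_def by (subst (1) m) (simp add: mult_ac)
  also have "(\<Prod>p\<in>?P. real p) * (\<Prod>p\<in>?P. 1 + 1 / real p) = (\<Prod>p\<in>?P. real (p + 1))"
    unfolding prod.distrib[symmetric]
    by (rule prod.cong) (auto dest!: pos simp: field_simps)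
  also have "real m * (\<Prod>p\<in>?P. real (p + 1)) = real (m * (\<Prod>p\<in>?P. p + 1))"
    by simp
  finally have psi: "dedekind_psi n = real (m * (\<Prod>p\<in>?P. p + 1))" .
  have "1 \<le> (\<Prod>p\<in>?P. 1 + 1 / real p)"
    by (rule prod_ge_1) simp
  then have "real n * 1 \<le> dedekind_psi n"
    unfolding dedekind_psi_def by (intro mult_left_mono) auto
  then have "n \<le> m * (\<Prod>p\<in>?P. p + 1)"
    unfolding psi by (metis mult.right_neutral of_nat_le_iff)
  then have eq: "dedekind_psi n - real n = real (m * (\<Prod>p\<in>?P. p + 1) - n)"
    unfolding psi by (simp only: of_nat_diff)
  show ?thesis
    unfolding dedekind_T_def eq by (simp only: floor_of_nat nat_int)
qed

text \<open>
  The iterate \<open>T\<^sup>(\<^sup>j\<^sup>)(n)\<close> is \<open>(dedekind_T ^^ j) n\<close>. It counts as defined only if all earlier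
  iterates are positive; the last one itself may be \<open>0\<close>.
\<close>

definition T_iterate_defined :: "nat \<Rightarrow> nat \<Rightarrow> bool" where
  "T_iterate_defined j n \<longleftrightarrow> (\<forall>i<j. (dedekind_T ^^ i) n > 0)"

definition has_asymptotic_density :: "nat set \<Rightarrow> real \<Rightarrow> bool" where
  "has_asymptotic_density A d \<longleftrightarrow>
     ((\<lambda>x::real. real (card {n \<in> A. 0 < n \<and> real n \<le> x}) / x) \<longlongrightarrow> d) at_top"

end

theory Submission
  imports Defs "HOL-Analysis.Analysis" "HOL-Number_Theory.Number_Theory"
    "HOL-Computational_Algebra.Squarefree"
begin

text \<open>
  If \<open>p\<close> divides \<open>m\<close> and a prime \<open>q \<equiv> -1\<close> modulo \<open>p\<close> also divides \<open>m\<close>, then \<open>p\<close> divides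
  \<open>q + 1\<close>, hence \<open>\<psi>(m)\<close>, hence \<open>T(m) = \<psi>(m) - m\<close>. The sum of \<open>1/q\<close> over primes \<open>q \<equiv> -1\<close>
  diverges, so almost all \<open>n\<close> are divisible by such a \<open>q\<close> from a fixed finite set up to a set of
  small density. Induction on \<open>j\<close> shows that for each fixed \<open>p\<close> almost all multiples \<open>n\<close> of \<open>p\<close>
  have \<open>T\<^sup>j(n)\<close> divisible by \<open>p\<close>: the small primes of \<open>n\<close> persist along the orbit. Since
  \<open>T(m)/m + 1\<close> is the product of \<open>1 + 1/p\<close> over the primes dividing \<open>m\<close>, and the contribution to
  \<open>T(n)/n\<close> of divisors beyond \<open>y\<close> is at most \<open>1/y\<close> on average, the ratios along the orbit are
  at least \<open>(1 - \<epsilon>) T(n)/n\<close>.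

  The divergence is Dirichlet's theorem for a prime modulus. It is proved following Shapiro, with
  finite sums weighted by the von Mangoldt function; that real characters satisfy
  \<open>L(1, \<chi>) \<noteq> 0\<close> is Monsky's Lambert series argument.
\<close>

section \<open>Chebyshev and Mertens bounds\<close>

text \<open>The obstacle is that the bound wanted is relative, while the error from large divisors
  is additive and \<open>T(n)/n\<close> has no positive lower bound on a set of density 1. So every
  estimate concedes a set of density \<delta>: outside it \<open>n\<close> has a prime factor at
  most some \<open>w\<close>, whence \<open>T(n)/n\<close> is at least \<open>1/w\<close>, and the
  cut-off \<open>y\<close> is chosen in terms of \<epsilon>, \<delta> and \<open>w\<close>. All sets
  of primes are thereby finite and fixed before \<open>n\<close> varies, which is why mere
  divergence of the sum of \<open>1/q\<close> and a crude sieve suffice. Letting \<delta> tend to 0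
  leaves a null exceptional set for each fixed \<epsilon>, and a diagonal choice of \<epsilon> turns
  these into one set of density 1 with an error tending to 0. Only a lower bound is claimed, so
  primes acquired along the orbit can only help.\<close>

lemma sum_divisors_swap:
  fixes f :: "nat \<Rightarrow> nat \<Rightarrow> 'a :: comm_monoid_add"
  shows "(\<Sum>n=1..x. \<Sum>d | d dvd n. f d (n div d)) = (\<Sum>d=1..x. \<Sum>m=1..x div d. f d m)"
proof -
  have "(\<Sum>n=1..x. \<Sum>d | d dvd n. f d (n div d))
      = (\<Sum>(n, d)\<in>(SIGMA n:{1..x}. {d. d dvd n}). f d (n div d))"
    by (subst sum.Sigma) auto
  also have "\<dots> = (\<Sum>(d, m)\<in>(SIGMA d:{1..x}. {1..x div d}). f d m)"
  proof (rule sum.reindex_bij_witness[where i = "\<lambda>(d, m). (d * m, d)" and j = "\<lambda>(n, d). (d, n div d)"])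
    show "(\<lambda>(n, d). (d, n div d)) a \<in> (SIGMA d:{1..x}. {1..x div d})"
      if "a \<in> (SIGMA n:{1..x}. {d. d dvd n})" for a
      using that by (auto elim!: dvdE simp: less_eq_div_iff_mult_less_eq mult_ac Suc_le_eq)
        (metis One_nat_def Suc_leI mult.right_neutral mult_le_mono2 order.trans)
    show "(\<lambda>(d, m). (d * m, d)) b \<in> (SIGMA n:{1..x}. {d. d dvd n})"
      if "b \<in> (SIGMA d:{1..x}. {1..x div d})" for b
      using that by (auto simp: less_eq_div_iff_mult_less_eq mult_ac)
  qed auto
  also have "\<dots> = (\<Sum>d=1..x. \<Sum>m=1..x div d. f d m)"
    by (subst sum.Sigma) auto
  finally show ?thesis .
qed

lemma ln_fact_ge: "ln (fact n) \<ge> real n * ln (real n) - real n"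
proof (induction n)
  case (Suc n)
  show ?case
  proof (cases "n = 0")
    case False
    have "ln (real (Suc n) / real n) \<le> real (Suc n) / real n - 1"
      using False by (intro ln_le_minus_one) auto
    hence "real n * ln (real (Suc n) / real n) \<le> 1"
      using False by (simp add: field_simps)
    hence "real n * ln (real (Suc n)) - real n * ln (real n) \<le> 1"
      using False by (simp add: ln_div right_diff_distrib del: of_nat_Suc)
    moreover have "ln (fact (Suc n)) = ln (real (Suc n)) + ln (fact n)"
      by (simp add: ln_mult del: of_nat_Suc)
    moreover have "real (Suc n) * ln (real (Suc n)) = real n * ln (real (Suc n)) + ln (real (Suc n))"
      by (simp add: algebra_simps)
    ultimately show ?thesis using Suc.IH by simp
  qed auto
qed auto

lemma ln_fact_le: "ln (fact n) \<le> real n * ln (real n)"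
proof (cases "n = 0")
  case False
  have "ln (fact n) \<le> ln (real n ^ n)"
    by (subst ln_le_cancel_iff) (use False fact_le_power[of n, where 'a = real] in auto)
  thus ?thesis using False by (simp add: ln_realpow)
qed auto

text \<open>Legendre's formula for the factorial: \<open>ln n\<close> is the sum of
  \<open>mangoldt d\<close> over \<open>d\<close> dividing \<open>n\<close>, and \<open>d\<close>
  has \<open>x div d\<close> multiples up to \<open>x\<close>.\<close>

lemma sum_mangoldt_div: "(\<Sum>d=1..x. mangoldt d * real (x div d)) = ln (fact x)"
proof -
  have "(\<Sum>d=1..x. mangoldt d * real (x div d)) = (\<Sum>d=1..x. \<Sum>m=1..x div d. mangoldt d :: real)"
    by (simp add: mult.commute)
  also have "\<dots> = (\<Sum>n=1..x. \<Sum>d | d dvd n. mangoldt d)"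
    by (rule sum_divisors_swap[symmetric])
  also have "\<dots> = (\<Sum>n=1..x. ln (real n))"
    by (intro sum.cong refl) (use mangoldt_sum[where 'a = real] in auto)
  also have "\<dots> = ln (\<Prod>n=1..x. real n)"
    by (rule ln_prod[symmetric]) auto
  also have "(\<Prod>n=1..x. real n) = fact x"
    by (simp add: fact_prod)
  finally show ?thesis .
qed

text \<open>Chebyshev's argument: in the logarithm of the central binomial coefficient,
  \<open>mangoldt d\<close> has the coefficient \<open>c d\<close>, which is never negative and is
  at least 1 for \<open>n < d \<le> 2 * n\<close>; the coefficient itself is at most
  \<open>4 ^ n\<close>.\<close>

lemma sum_mangoldt_double:
  "(\<Sum>d=1..2*n. mangoldt d :: real) \<le> (\<Sum>d=1..n. mangoldt d) + 2 * real n"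
proof -
  define c where "c d = real (2 * n div d) - 2 * real (n div d)" for d
  have c_nonneg: "c d \<ge> 0" for d
  proof -
    have "2 * (n div d) \<le> 2 * n div d"
      by (cases "d = 0") (auto simp: less_eq_div_iff_mult_less_eq)
    hence "real (2 * (n div d)) \<le> real (2 * n div d)"
      by (subst of_nat_le_iff)
    thus ?thesis by (simp add: c_def)
  qed
  have "(\<Sum>d=n+1..2*n. mangoldt d :: real) \<le> (\<Sum>d=n+1..2*n. mangoldt d * c d)"
  proof (rule sum_mono)
    fix d assume d: "d \<in> {n+1..2*n}"
    hence "1 \<le> 2 * n div d" by (simp add: less_eq_div_iff_mult_less_eq)
    moreover have "n div d = 0" using d by simp
    ultimately have "c d \<ge> 1" by (simp add: c_def)
    thus "mangoldt d \<le> mangoldt d * c d"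
      using mult_left_mono[of 1 "c d" "mangoldt d"] mangoldt_nonneg[of d] by simp
  qed
  also have "\<dots> \<le> (\<Sum>d=1..2*n. mangoldt d * c d)"
    by (intro sum_mono2) (auto intro!: mult_nonneg_nonneg mangoldt_nonneg c_nonneg)
  also have "\<dots> = (\<Sum>d=1..2*n. mangoldt d * real (2 * n div d))
                   - 2 * (\<Sum>d=1..2*n. mangoldt d * real (n div d))"
    by (simp add: c_def sum_subtractf sum_distrib_left algebra_simps)
  also have "(\<Sum>d=1..2*n. mangoldt d * real (n div d)) = (\<Sum>d=1..n. mangoldt d * real (n div d))"
    by (intro sum.mono_neutral_right) auto
  also have "(\<Sum>d=1..2*n. mangoldt d * real (2 * n div d)) - 2 * \<dots>
               = ln (fact (2 * n)) - 2 * ln (fact n)"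
    by (simp only: sum_mangoldt_div)
  also have "\<dots> = ln (fact (2 * n) / (fact n * fact n))"
    by (simp add: ln_div ln_mult)
  also have "fact (2 * n) / (fact n * fact n) = real (2 * n choose n)"
    by (subst binomial_fact) (auto simp: mult_2)
  also have "ln (real (2 * n choose n)) \<le> ln (real (2 ^ (2 * n)))"
    by (subst ln_le_cancel_iff) (use binomial_le_pow2[of "2 * n" n] in \<open>auto simp: of_nat_le_iff\<close>)
  also have "\<dots> = 2 * real n * ln 2" by (simp add: ln_realpow)
  also have "\<dots> \<le> 2 * real n * 1"
    by (intro mult_left_mono) (use ln_le_minus_one[of "2::real"] in auto)
  finally have "(\<Sum>d=n+1..2*n. mangoldt d :: real) \<le> 2 * real n" by simp
  moreover have "(\<Sum>d=1..2*n. mangoldt d :: real) = (\<Sum>d=1..n. mangoldt d) + (\<Sum>d=n+1..2*n. mangoldt d)"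
    by (subst sum.union_disjoint[symmetric]) (auto intro!: sum.cong)
  ultimately show ?thesis by simp
qed

lemma chebyshev_mangoldt: "(\<Sum>d=1..n. mangoldt d :: real) \<le> 4 * real n"
proof (induction n rule: less_induct)
  case (less n)
  show ?case
  proof (cases "n \<le> 1")
    case True
    hence "n = 0 \<or> n = 1" by auto
    thus ?thesis by auto
  next
    case False
    define m where "m = (n + 1) div 2"
    have m: "m < n" "n \<le> 2 * m" "2 * m \<le> n + 1" using False by (auto simp: m_def)
    have "(\<Sum>d=1..n. mangoldt d :: real) \<le> (\<Sum>d=1..2*m. mangoldt d)"
      by (intro sum_mono2) (use m in \<open>auto intro: mangoldt_nonneg\<close>)
    also have "\<dots> \<le> 4 * real m + 2 * real m"
      using sum_mangoldt_double[of m] less.IH[OF m(1)] by linarith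
    \<comment> \<open>Since \<open>2 * m \<le> n + 1\<close>, the left side is at most
      \<open>3 * n + 3\<close>, which is good enough from \<open>n = 3\<close> on; the constant 4
      pays for rounding up in \<open>m\<close>.\<close>
    also have "\<dots> \<le> 4 * real n"
    proof (cases "n = 2")
      case True
      hence "m = 1" using m by linarith
      thus ?thesis using True by simp
    next
      case 2: False
      thus ?thesis using m False by linarith
    qed
    finally show ?thesis .
  qed
qed

lemma mertens_lower: "x > 0 \<Longrightarrow> (\<Sum>d=1..x. mangoldt d / real d) \<ge> ln (real x) - 1"
proof -
  assume x: "x > 0"
  have "real x * ln (real x) - real x \<le> (\<Sum>d=1..x. mangoldt d * real (x div d))"
    using ln_fact_ge[of x] by (simp only: sum_mangoldt_div)
  also have "\<dots> \<le> (\<Sum>d=1..x. mangoldt d * (real x / real d))"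
    by (intro sum_mono mult_left_mono mangoldt_nonneg of_nat_div_le_of_nat)
  also have "\<dots> = real x * (\<Sum>d=1..x. mangoldt d / real d)"
    by (simp add: sum_distrib_left mult_ac)
  finally have "real x * (ln (real x) - 1) \<le> real x * (\<Sum>d=1..x. mangoldt d / real d)"
    by (simp add: algebra_simps)
  thus ?thesis using x by (simp only: mult_le_cancel_left_pos of_nat_0_less_iff)
qed

text \<open>Replacing each \<open>x div d\<close> by \<open>x / d\<close> costs at most
  \<open>mangoldt d\<close>, and Chebyshev's bound makes the total cost \<open>4 * x\<close>; this
  is the 4 in the statement.\<close>

lemma mertens_upper: "x > 0 \<Longrightarrow> (\<Sum>d=1..x. mangoldt d / real d) \<le> ln (real x) + 4"
proof -
  assume x: "x > 0"
  have "real x * (\<Sum>d=1..x. mangoldt d / real d) = (\<Sum>d=1..x. mangoldt d * (real x / real d))"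
    by (simp add: sum_distrib_left mult_ac)
  also have "\<dots> \<le> (\<Sum>d=1..x. mangoldt d * (real (x div d) + 1))"
  proof (intro sum_mono mult_left_mono mangoldt_nonneg)
    fix d assume "d \<in> {1..x}"
    hence "x < (x div d + 1) * d" using dividend_less_div_times[of d x] by simp
    hence "real x < real ((x div d + 1) * d)" by (subst of_nat_less_iff)
    thus "real x / real d \<le> real (x div d) + 1"
      using \<open>d \<in> {1..x}\<close> by (simp add: field_simps)
  qed
  also have "\<dots> = (\<Sum>d=1..x. mangoldt d * real (x div d)) + (\<Sum>d=1..x. mangoldt d)"
    by (simp add: algebra_simps sum.distrib)
  also have "\<dots> \<le> real x * ln (real x) + 4 * real x"
    unfolding sum_mangoldt_div using chebyshev_mangoldt[of x] ln_fact_le[of x] by linarith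
  finally have "real x * (\<Sum>d=1..x. mangoldt d / real d) \<le> real x * (ln (real x) + 4)"
    by (simp add: algebra_simps)
  thus ?thesis using x by (simp only: mult_le_cancel_left_pos of_nat_0_less_iff)
qed

lemma sum_inverse_powers_le:
  assumes "q \<ge> 2"
  shows "(\<Sum>k=2..K. 1 / real q ^ k) \<le> 2 / real q ^ 2"
proof -
  \<comment> \<open>The subtracted term makes the induction close; the step uses
    \<open>q \<ge> 2\<close>.\<close>
  have "(\<Sum>k=2..K. 1 / real q ^ k) \<le> 2 / real q ^ 2 - 2 / real q ^ Suc K" if "K \<ge> 1"
    using that
  proof (induction K rule: nat_induct_at_least)
    case base
    show ?case by (simp add: power2_eq_square)
  next
    case (Suc K)
    have *: "2 / real q ^ Suc (Suc K) \<le> 1 / real q ^ Suc K"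
      using assms by (simp add: field_simps)
    have "(\<Sum>k=2..Suc K. 1 / real q ^ k) = (\<Sum>k=2..K. 1 / real q ^ k) + 1 / real q ^ Suc K"
      using Suc.hyps by simp
    thus ?case using Suc.IH * by simp
  qed
  moreover have "2 / real q ^ Suc K \<ge> 0" by simp
  ultimately show ?thesis by (cases "K = 0") (auto simp: not_le intro: order.trans)
qed

text \<open>Only prime powers \<open>q ^ k\<close> with \<open>k \<ge> 2\<close> count. Their
  geometric series leaves at most \<open>2 * ln q / q ^ 2\<close>, and \<open>ln q\<close> is at
  most twice the square root of \<open>q\<close>, which gives the convergent majorant.\<close>

lemma mangoldt_nonprime_bound:
  "\<exists>C. \<forall>x. (\<Sum>n | n \<in> {1..x} \<and> \<not> prime n. mangoldt n / real n) \<le> C"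
proof -
  have sm: "summable (\<lambda>q. 4 * (real q powr (-3/2)))"
    by (intro summable_mult) (simp add: summable_real_powr_iff)
  have "(\<Sum>n | n \<in> {1..x} \<and> \<not> prime n. mangoldt n / real n) \<le> (\<Sum>q. 4 * (real q powr (-3/2)))" for x
  proof -
    define I where "I = {q\<in>{2..x}. prime q} \<times> {2..x}"
    let ?f = "\<lambda>(q::nat, k::nat). q ^ k"
    have "(\<Sum>n | n \<in> {1..x} \<and> \<not> prime n. mangoldt n / real n)
            = (\<Sum>n | n \<in> {1..x} \<and> \<not> prime n \<and> primepow n. mangoldt n / real n)"
      by (rule sum.mono_neutral_right) (auto simp: mangoldt_def)
    also have "\<dots> \<le> (\<Sum>n\<in>?f ` I. mangoldt n / real n)"
    proof (rule sum_mono2)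
      show "{n. n \<in> {1..x} \<and> \<not> prime n \<and> primepow n} \<subseteq> ?f ` I"
      proof safe
        fix n assume n: "n \<in> {1..x}" "\<not> prime n" "primepow n"
        then obtain q k where qk: "prime q" "k > 0" "n = q ^ k"
          by (auto simp: primepow_def)
        have "k \<noteq> 1" using n qk by auto
        hence "k \<ge> 2" using qk by simp
        have "q \<ge> 2" using qk prime_ge_2_nat by auto
        have "k < 2 ^ k" by (rule less_exp)
        also have "2 ^ k \<le> q ^ k" using \<open>q \<ge> 2\<close> by (intro power_mono) auto
        finally have "k \<le> x" using n qk by auto
        moreover have "q \<le> q ^ k" using \<open>q \<ge> 2\<close> qk by (intro self_le_power) auto
        ultimately have "(q, k) \<in> I" using n qk \<open>k \<ge> 2\<close> \<open>q \<ge> 2\<close> by (auto simp: I_def)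
        thus "n \<in> ?f ` I" using qk by force
      qed
    qed (auto simp: I_def intro!: divide_nonneg_nonneg mangoldt_nonneg)
    also have "\<dots> \<le> sum ((\<lambda>n. mangoldt n / real n) \<circ> ?f) I"
      by (rule sum_image_le) (auto simp: I_def intro!: divide_nonneg_nonneg mangoldt_nonneg)
    also have "\<dots> = (\<Sum>(q, k)\<in>I. ln (real q) * (1 / real q ^ k))"
      by (intro sum.cong) (auto simp: I_def)
    also have "\<dots> = (\<Sum>q | q \<in> {2..x} \<and> prime q. ln (real q) * (\<Sum>k=2..x. 1 / real q ^ k))"
      unfolding I_def by (subst sum.Sigma [symmetric]) (auto simp: sum_distrib_left)
    also have "\<dots> \<le> (\<Sum>q | q \<in> {2..x} \<and> prime q. 4 * (real q powr (-3/2)))"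
    proof (rule sum_mono)
      fix q assume q: "q \<in> {q. q \<in> {2..x} \<and> prime q}"
      hence q2: "q \<ge> 2" by auto
      have "ln (real q) = 2 * ln (real q powr (1/2))" using q2 by (simp add: ln_powr)
      also have "\<dots> \<le> 2 * real q powr (1/2)"
        using ln_le_minus_one[of "real q powr (1/2)"] q2 by simp
      finally have ln: "ln (real q) \<le> 2 * real q powr (1/2)" .
      have "ln (real q) * (\<Sum>k=2..x. 1 / real q ^ k) \<le> (2 * real q powr (1/2)) * (2 / real q ^ 2)"
        by (intro mult_mono sum_inverse_powers_le ln q2 sum_nonneg) auto
      also have "\<dots> = 4 * (real q powr (1/2) * real q powr (-2))"
        using q2 by (simp add: powr_minus powr_numeral field_simps)
      also have "\<dots> = 4 * real q powr (-3/2)"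
        using q2 by (subst powr_add [symmetric]) auto
      finally show "ln (real q) * (\<Sum>k=2..x. 1 / real q ^ k) \<le> 4 * (real q powr (-3/2))" .
    qed
    also have "\<dots> \<le> (\<Sum>q. 4 * (real q powr (-3/2)))"
      by (rule sum_le_suminf[OF sm]) auto
    finally show ?thesis .
  qed
  thus ?thesis by blast
qed

section \<open>The Moebius function\<close>

definition moebius :: "nat \<Rightarrow> real" where
  "moebius n = (if squarefree n then (-1) ^ card (prime_factors n) else 0)"

lemma abs_moebius_le: "\<bar>moebius n\<bar> \<le> 1"
  by (simp add: moebius_def power_abs)

text \<open>Each divisor of \<open>p ^ k * m\<close> is \<open>p ^ i * d\<close> for exactly one
  \<open>i \<le> k\<close> and one \<open>d\<close> dividing \<open>m\<close>. This peels one prime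
  off a divisor sum, both for \<open>moebius\<close> and for real characters.\<close>

lemma sum_divisors_prime_power_mult:
  fixes f :: "nat \<Rightarrow> 'a :: comm_monoid_add"
  assumes "prime p" "\<not> p dvd m" "m > 0"
  shows "(\<Sum>d | d dvd p ^ k * m. f d) = (\<Sum>d | d dvd m. \<Sum>i\<le>k. f (p ^ i * d))"
proof -
  have nz: "p ^ k * m \<noteq> 0" using assms by auto
  have mult_pm: "multiplicity p (p ^ i * d) = i" if "d dvd m" for i d
  proof -
    have "\<not> p dvd d" using that assms dvd_trans by blast
    thus ?thesis
      using assms prime_gt_1_nat[of p] by (intro multiplicity_decomposeI[of _ _ _ d]) auto
  qed
  have "(\<Sum>d | d dvd m. \<Sum>i\<le>k. f (p ^ i * d)) = (\<Sum>(d, i)\<in>{d. d dvd m} \<times> {..k}. f (p ^ i * d))"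
    using assms by (subst sum.Sigma) auto
  also have "\<dots> = (\<Sum>d | d dvd p ^ k * m. f d)"
  proof (rule sum.reindex_bij_witness[where i = "\<lambda>d. (d div p ^ multiplicity p d, multiplicity p d)"
          and j = "\<lambda>(d, i). p ^ i * d"])
    fix D assume D: "D \<in> {d. d dvd p ^ k * m}"
    hence Dnz: "D \<noteq> 0" using nz by (intro notI) simp
    have unit: "\<not> is_unit p" using assms by auto
    obtain e where e: "D = p ^ multiplicity p D * e" "\<not> p dvd e"
      using multiplicity_decompose'[OF Dnz unit] by metis
    have "multiplicity p D \<le> multiplicity p (p ^ k * m)"
      using D nz by (intro dvd_imp_multiplicity_le) auto
    hence le: "multiplicity p D \<le> k" using mult_pm[of m k] by simp
    have "e dvd p ^ k * m" using D e(1) by (metis dvd_mult_right mem_Collect_eq)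
    moreover have "coprime e (p ^ k)"
      using e(2) assms by (metis coprime_commute coprime_power_right_iff prime_imp_coprime)
    ultimately have "e dvd m" by (simp add: coprime_dvd_mult_right_iff)
    moreover have "D div p ^ multiplicity p D = e"
    proof -
      have "p ^ multiplicity p D > 0" using assms prime_gt_0_nat by simp
      thus ?thesis by (metis e(1) nonzero_mult_div_cancel_left not_gr_zero)
    qed
    ultimately show "(D div p ^ multiplicity p D, multiplicity p D) \<in> {d. d dvd m} \<times> {..k}"
      and "(case (D div p ^ multiplicity p D, multiplicity p D) of (d, i) \<Rightarrow> p ^ i * d) = D"
      using le e(1) by auto
  next
    fix a assume a: "a \<in> {d. d dvd m} \<times> {..k}"
    obtain d i where di: "a = (d, i)" "d dvd m" "i \<le> k" using a by auto
    show "(case a of (d, i) \<Rightarrow> p ^ i * d) \<in> {d. d dvd p ^ k * m}"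
      using di by (auto intro!: mult_dvd_mono le_imp_power_dvd)
    show "((case a of (d, i) \<Rightarrow> p ^ i * d) div p ^ multiplicity p (case a of (d, i) \<Rightarrow> p ^ i * d),
            multiplicity p (case a of (d, i) \<Rightarrow> p ^ i * d)) = a"
      using di mult_pm[of d i] assms prime_gt_0_nat[of p] by simp
  qed auto
  finally show ?thesis by simp
qed

lemma moebius_mult_prime:
  assumes "prime p" "\<not> p dvd d"
  shows "moebius (p * d) = - moebius d"
proof -
  have d0: "d \<noteq> 0" using assms(2) by (intro notI) simp
  have "coprime p d" using assms prime_imp_coprime by blast
  hence "squarefree (p * d) \<longleftrightarrow> squarefree d"
    using assms squarefree_prime[of p] by (auto simp: squarefree_mult_coprime dest: squarefree_multD)
  moreover have "card (prime_factors (p * d)) = Suc (card (prime_factors d))"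
    using assms d0 by (subst prime_factors_product)
      (auto simp: prime_factorization_prime in_prime_factors_iff prime_gt_0_nat)
  ultimately show ?thesis by (simp add: moebius_def)
qed

text \<open>Peeling off one prime \<open>p\<close> of \<open>n\<close>, only the exponents 0 and 1
  of \<open>p\<close> give squarefree divisors, and these two terms cancel.\<close>

lemma sum_moebius_divisors:
  assumes "n > 0"
  shows "(\<Sum>d | d dvd n. moebius d) = (if n = 1 then 1 else 0)"
proof (cases "n = 1")
  case True
  thus ?thesis by (simp add: moebius_def)
next
  case False
  then obtain p where p: "prime p" "p dvd n" using prime_factor_nat by blast
  obtain m where m: "n = p ^ multiplicity p n * m" "\<not> p dvd m"
    using multiplicity_decompose'[of n p] assms p by (metis not_gr_zero not_prime_unit)
  define k where "k = multiplicity p n"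
  have k: "k > 0" using p assms by (simp add: k_def prime_multiplicity_gt_zero_iff)
  have m0: "m > 0" using m(2) by (cases "m = 0") auto
  have "(\<Sum>d | d dvd n. moebius d) = (\<Sum>d | d dvd m. \<Sum>i\<le>k. moebius (p ^ i * d))"
    by (subst m(1), fold k_def) (rule sum_divisors_prime_power_mult[OF p(1) m(2) m0])
  also have "\<dots> = (\<Sum>d | d dvd m. 0)"
  proof (intro sum.cong refl)
    fix d assume d: "d \<in> {d. d dvd m}"
    hence "\<not> p dvd d" using m(2) dvd_trans by blast
    have "(\<Sum>i\<le>k. moebius (p ^ i * d)) = (\<Sum>i\<in>{0, 1}. moebius (p ^ i * d))"
    proof (rule sum.mono_neutral_right)
      show "\<forall>i\<in>{..k} - {0, 1}. moebius (p ^ i * d) = 0"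
      proof
        fix i assume "i \<in> {..k} - {0, 1}"
        hence "p ^ 2 dvd p ^ i * d" by (intro dvd_mult2 le_imp_power_dvd) auto
        hence "\<not> squarefree (p ^ i * d)"
          using p(1) by (metis not_prime_unit squarefree_def)
        thus "moebius (p ^ i * d) = 0" by (simp add: moebius_def)
      qed
    qed (use k in auto)
    also have "\<dots> = 0" using moebius_mult_prime[OF p(1) \<open>\<not> p dvd d\<close>] by simp
    finally show "(\<Sum>i\<le>k. moebius (p ^ i * d)) = 0" .
  qed
  finally show ?thesis using False by simp
qed

text \<open>Moebius inversion of the identity that expresses \<open>ln\<close> as the divisor sum of
  \<open>mangoldt\<close>.\<close>

lemma sum_moebius_ln:
  assumes "n > 0"
  shows "(\<Sum>d | d dvd n. moebius d * ln (real (n div d))) = mangoldt n"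
proof -
  have "(\<Sum>d | d dvd n. moebius d * ln (real (n div d)))
      = (\<Sum>d | d dvd n. \<Sum>e | e dvd n div d. moebius d * mangoldt e)"
  proof (intro sum.cong refl)
    fix d assume "d \<in> {d. d dvd n}"
    hence "n div d \<noteq> 0" using assms by (auto elim!: dvdE)
    thus "moebius d * ln (real (n div d)) = (\<Sum>e | e dvd n div d. moebius d * mangoldt e)"
      using mangoldt_sum[of "n div d", where 'a = real] by (simp add: sum_distrib_left [symmetric])
  qed
  also have "\<dots> = (\<Sum>(d, e)\<in>(SIGMA d:{d. d dvd n}. {e. e dvd n div d}). moebius d * mangoldt e)"
    using assms by (subst sum.Sigma) (auto elim!: dvdE)
  also have "\<dots> = (\<Sum>(e, d)\<in>(SIGMA e:{e. e dvd n}. {d. d dvd n div e}). moebius d * mangoldt e)"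
    using assms
    by (intro sum.reindex_bij_witness[where i = prod.swap and j = prod.swap]) (auto elim!: dvdE)
  also have "\<dots> = (\<Sum>e | e dvd n. \<Sum>d | d dvd n div e. moebius d * mangoldt e)"
    using assms by (subst sum.Sigma) (auto elim!: dvdE)
  also have "\<dots> = (\<Sum>e | e dvd n. mangoldt e * (if e = n then 1 else 0))"
  proof (intro sum.cong refl)
    fix e assume e: "e \<in> {e. e dvd n}"
    hence *: "n div e > 0" "n div e = 1 \<longleftrightarrow> e = n" using assms by (auto elim!: dvdE)
    show "(\<Sum>d | d dvd n div e. moebius d * mangoldt e) = mangoldt e * (if e = n then 1 else 0)"
      using sum_moebius_divisors[OF *(1)] *(2) by (simp add: sum_distrib_right [symmetric])
  qed
  also have "\<dots> = mangoldt n" using assms by (simp add: sum.delta if_distrib cong: if_cong)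
  finally show ?thesis .
qed

text \<open>With \<open>x\<close> in place of \<open>n\<close> inside the logarithm, inversion
  acquires an extra \<open>ln x\<close> at \<open>n = 1\<close> only. This is the source of the
  \<open>ln x\<close> that accompanies a vanishing \<open>L\<close>.\<close>

lemma sum_moebius_ln_divide:
  assumes "n > 0" "x > 0"
  shows "(\<Sum>d | d dvd n. moebius d * ln (real x / real d)) = (if n = 1 then ln (real x) else 0) + mangoldt n"
proof -
  have "(\<Sum>d | d dvd n. moebius d * ln (real x / real d))
      = (\<Sum>d | d dvd n. moebius d * (ln (real x) - ln (real n)) + moebius d * ln (real (n div d)))"
    using assms by (intro sum.cong refl) (auto elim!: dvdE simp: ln_div ln_mult algebra_simps)
  also have "\<dots> = (\<Sum>d | d dvd n. moebius d) * (ln (real x) - ln (real n)) + mangoldt n"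
    using assms by (simp add: sum.distrib sum_distrib_right sum_moebius_ln)
  finally show ?thesis using assms by (simp add: sum_moebius_divisors)
qed

section \<open>Sums of characters against the von Mangoldt function\<close>

text \<open>The telescoping part contributes \<open>B * (g (a + 1) - g (b + 1))\<close> and the two
  boundary terms \<open>B * g (b + 1)\<close> and \<open>B * g (a + 1)\<close>. Monotonicity is
  asked for only beyond \<open>a\<close> because \<open>ln n / n\<close> starts to decrease at
  3.\<close>

lemma abel_summation_bound:
  fixes f :: "nat \<Rightarrow> 'a :: real_normed_vector" and g :: "nat \<Rightarrow> real"
  assumes bound: "\<And>N. norm (\<Sum>n=1..N. f n) \<le> B"
  assumes decr: "\<And>n. n > a \<Longrightarrow> g (Suc n) \<le> g n" and nonneg: "\<And>n. n > a \<Longrightarrow> 0 \<le> g n"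
  shows "norm (\<Sum>n=Suc a..b. g n *\<^sub>R f n) \<le> 2 * B * g (Suc a)"
proof -
  define F where "F N = (\<Sum>n=1..N. f n)" for N
  have F: "norm (F N) \<le> B" for N using bound by (simp add: F_def)
  have B: "B \<ge> 0" using F[of 0] by (simp add: F_def)
  show ?thesis
  proof (cases "a \<le> b")
    case False
    thus ?thesis using B nonneg by simp
  next
    case True
    have eq: "(\<Sum>n=Suc a..b. g n *\<^sub>R f n)
        = (\<Sum>n=Suc a..b. (g n - g (Suc n)) *\<^sub>R F n) + g (Suc b) *\<^sub>R F b - g (Suc a) *\<^sub>R F a"
      using True
    proof (induction b rule: dec_induct)
      case (step b)
      have "F (Suc b) = F b + f (Suc b)" by (simp add: F_def)
      thus ?case using step by (simp add: algebra_simps)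
    qed auto
    have "norm (\<Sum>n=Suc a..b. (g n - g (Suc n)) *\<^sub>R F n) \<le> (\<Sum>n=Suc a..b. (g n - g (Suc n)) * B)"
      using decr F by (intro sum_norm_le) (auto intro!: mult_left_mono)
    also have "\<dots> = B * (\<Sum>n=Suc a..b. g n - g (Suc n))"
      by (simp add: sum_distrib_left mult.commute)
    also have "(\<Sum>n=Suc a..b. g n - g (Suc n)) = g (Suc a) - g (Suc b)"
      using True by (induction b rule: dec_induct) auto
    finally have 1: "norm (\<Sum>n=Suc a..b. (g n - g (Suc n)) *\<^sub>R F n) \<le> B * (g (Suc a) - g (Suc b))" .
    have 2: "norm (g (Suc b) *\<^sub>R F b) \<le> B * g (Suc b)" "norm (g (Suc a) *\<^sub>R F a) \<le> B * g (Suc a)"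
      using F nonneg[of "Suc b"] nonneg[of "Suc a"] True by (auto simp: mult.commute[of B] intro!: mult_left_mono)
    show ?thesis unfolding eq
      using 1 2 norm_triangle_ineq4[of "(\<Sum>n=Suc a..b. (g n - g (Suc n)) *\<^sub>R F n) + g (Suc b) *\<^sub>R F b"
          "g (Suc a) *\<^sub>R F a"]
        norm_triangle_ineq[of "(\<Sum>n=Suc a..b. (g n - g (Suc n)) *\<^sub>R F n)" "g (Suc b) *\<^sub>R F b"]
      by (simp add: algebra_simps)
  qed
qed

text \<open>What Shapiro's argument uses of a non-principal character is complete multiplicativity
  and bounded partial sums; periodicity enters only through \<open>B\<close>.\<close>

locale oscillating_character =
  fixes chi :: "nat \<Rightarrow> complex" and B :: real
  assumes one: "chi 1 = 1"
    and mult: "chi (m * n) = chi m * chi n"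
    and norm_le: "norm (chi n) \<le> 1"
    and partial_sums: "norm (\<Sum>n=1..N. chi n) \<le> B"
begin

lemma B_nonneg: "B \<ge> 0"
  using partial_sums[of 0] by simp

definition S :: "nat \<Rightarrow> complex" where "S y = (\<Sum>m=1..y. chi m / of_nat m)"

definition L :: complex where "L = lim S"

lemma S_diff: "a \<le> b \<Longrightarrow> norm (S b - S a) \<le> 2 * B / real (Suc a)"
proof -
  assume ab: "a \<le> b"
  have "{1..b} = {1..a} \<union> {Suc a..b}" using ab by auto
  hence "S b = S a + (\<Sum>m=Suc a..b. chi m / of_nat m)"
    unfolding S_def by (simp add: sum.union_disjoint)
  hence "S b - S a = (\<Sum>m=Suc a..b. (1 / real m) *\<^sub>R chi m)"
    by (simp add: scaleR_conv_of_real)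
  also have "norm \<dots> \<le> 2 * B * (1 / real (Suc a))"
    by (rule abel_summation_bound[OF partial_sums]) (auto simp: field_simps)
  finally show ?thesis by simp
qed

lemma S_tendsto: "S \<longlonglongrightarrow> L"
proof -
  have "Cauchy S"
  proof (rule metric_CauchyI)
    fix e :: real assume e: "e > 0"
    obtain N :: nat where N: "real N > 2 * B / e" using reals_Archimedean2 by blast
    have *: "dist (S n) (S m) < e" if "m \<ge> N" "n \<ge> m" for m n
    proof -
      have "dist (S n) (S m) \<le> 2 * B / real (Suc m)"
        using S_diff[OF that(2)] by (simp add: dist_norm)
      also have "\<dots> < e"
      proof -
        have "2 * B / e < real (Suc m)" using N that(1) by linarith
        thus ?thesis using e by (simp add: field_simps)
      qed
      finally show ?thesis .
    qed
    show "\<exists>M. \<forall>m\<ge>M. \<forall>n\<ge>M. dist (S m) (S n) < e"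
      using * by (metis dist_commute nle_le)
  qed
  thus ?thesis by (simp add: L_def Cauchy_convergent_iff convergent_LIMSEQ_iff)
qed

lemma S_tail: "norm (S y - L) \<le> 2 * B / real (Suc y)"
proof (rule LIMSEQ_le_const2)
  show "(\<lambda>b. norm (S y - S b)) \<longlonglongrightarrow> norm (S y - L)"
    by (intro tendsto_intros S_tendsto)
  show "\<exists>N. \<forall>n\<ge>N. norm (S y - S n) \<le> 2 * B / real (Suc y)"
    using S_diff[of y] by (metis norm_minus_commute)
qed

text \<open>The tail at \<open>x div d\<close> is of order \<open>d / x\<close>. The factor
  \<open>d\<close> cancels the \<open>1 / d\<close> of a coefficient, so that in convolution sums
  the errors reduce to a plain average over \<open>d \<le> x\<close>.\<close>

lemma S_tail_div:
  assumes "d \<in> {1..x}"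
  shows "norm (S (x div d) - L) \<le> 2 * B * (real d / real x)"
proof -
  have "x < (x div d + 1) * d" using assms dividend_less_div_times[of d x] by simp
  hence "real x < real ((x div d + 1) * d)" by (subst of_nat_less_iff)
  hence "1 / real (Suc (x div d)) \<le> real d / real x"
    using assms by (simp add: field_simps)
  hence "2 * B * (1 / real (Suc (x div d))) \<le> 2 * B * (real d / real x)"
    using B_nonneg by (intro mult_left_mono) auto
  thus ?thesis using S_tail[of "x div d"] by simp
qed

text \<open>Abel summation starts at 3, where \<open>ln n / n\<close> decreases; the term at 1 is 0,
  and the summand 1 in the bound covers the term at 2.\<close>

lemma sum_ln_bound: "norm (\<Sum>n=1..x. chi n * of_real (ln (real n)) / of_nat n) \<le> 1 + 2 * B * ln 3"
proof (cases "x \<ge> 2")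
  case True
  let ?h = "\<lambda>n. chi n * of_real (ln (real n)) / of_nat n"
  have "{1..x} = {1, 2} \<union> {Suc 2..x}" using True by auto
  hence "(\<Sum>n=1..x. ?h n) = ?h 2 + (\<Sum>n=Suc 2..x. ?h n)"
    by (simp add: sum.union_disjoint)
  also have "(\<Sum>n=Suc 2..x. ?h n) = (\<Sum>n=Suc 2..x. (ln (real n) / real n) *\<^sub>R chi n)"
    by (intro sum.cong) (auto simp: scaleR_conv_of_real)
  finally have eq: "(\<Sum>n=1..x. ?h n) = ?h 2 + (\<Sum>n=Suc 2..x. (ln (real n) / real n) *\<^sub>R chi n)" .
  have "norm (\<Sum>n=Suc 2..x. (ln (real n) / real n) *\<^sub>R chi n) \<le> 2 * B * (ln (real (Suc 2)) / real (Suc 2))"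
  proof (rule abel_summation_bound[OF partial_sums])
    fix n :: nat assume "n > 2"
    thus "ln (real (Suc n)) / real (Suc n) \<le> ln (real n) / real n"
      using exp_le by (intro ln_x_over_x_mono) auto
  qed auto
  also have "\<dots> \<le> 2 * B * ln 3" using B_nonneg by (simp add: mult_left_mono)
  finally have 1: "norm (\<Sum>n=Suc 2..x. (ln (real n) / real n) *\<^sub>R chi n) \<le> 2 * B * ln 3" .
  have "norm (?h 2) \<le> 1 * ln 2 / 2"
    using mult_right_mono[OF norm_le[of 2], of "ln 2"] by (simp add: norm_divide norm_mult)
  also have "\<dots> \<le> 1" using ln_le_minus_one[of "2::real"] by simp
  finally show ?thesis using 1 norm_triangle_ineq unfolding eq by (smt (verit))
next
  case False
  hence "x = 0 \<or> x = 1" by auto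
  thus ?thesis using B_nonneg by auto
qed

lemma chi_div: "d dvd n \<Longrightarrow> n > 0 \<Longrightarrow> chi n / of_nat n = (chi d / of_nat d) * (chi (n div d) / of_nat (n div d))"
  by (auto elim!: dvdE simp: mult)

definition K :: "nat \<Rightarrow> complex" where "K x = (\<Sum>n=1..x. chi n * mangoldt n / of_nat n)"

text \<open>Writing \<open>ln n\<close> as a divisor sum of \<open>mangoldt\<close> factors the
  bounded sum of \<open>chi n * ln n / n\<close> through the values \<open>S (x div d)\<close>.
  Replacing each of these by \<open>L\<close> yields \<open>L * K x\<close>, up to an error of at
  most \<open>8 * B\<close> by Chebyshev's bound.\<close>

lemma K_bounded:
  assumes "L \<noteq> 0"
  shows "\<exists>C. \<forall>x. norm (K x) \<le> C"
proof -
  have "norm (K x) \<le> (1 + 2 * B * ln 3 + 8 * B) / norm L" for x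
  proof (cases "x = 0")
    case False
    define c where "c d = chi d * mangoldt d / of_nat d" for d
    have "(\<Sum>n=1..x. chi n * of_real (ln (real n)) / of_nat n)
        = (\<Sum>n=1..x. \<Sum>d | d dvd n. c d * (chi (n div d) / of_nat (n div d)))"
    proof (intro sum.cong refl)
      fix n assume n: "n \<in> {1..x}"
      have "chi n * of_real (ln (real n)) / of_nat n = (\<Sum>d | d dvd n. chi n / of_nat n * mangoldt d)"
        using n mangoldt_sum[of n, where 'a = complex] by (simp only: sum_distrib_left [symmetric]) simp
      also have "\<dots> = (\<Sum>d | d dvd n. c d * (chi (n div d) / of_nat (n div d)))"
        using n by (intro sum.cong refl) (subst chi_div, auto simp: c_def)
      finally show "chi n * of_real (ln (real n)) / of_nat n
          = (\<Sum>d | d dvd n. c d * (chi (n div d) / of_nat (n div d)))" .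
    qed
    also have "\<dots> = (\<Sum>d=1..x. c d * S (x div d))"
      unfolding S_def sum_distrib_left by (rule sum_divisors_swap)
    also have "\<dots> = L * K x + (\<Sum>d=1..x. c d * (S (x div d) - L))"
    proof -
      have "K x = (\<Sum>d=1..x. c d)" by (simp add: K_def c_def)
      thus ?thesis by (simp add: sum_distrib_left sum.distrib [symmetric] algebra_simps)
    qed
    finally have eq: "L * K x = (\<Sum>n=1..x. chi n * of_real (ln (real n)) / of_nat n)
        - (\<Sum>d=1..x. c d * (S (x div d) - L))" by simp
    have "norm (\<Sum>d=1..x. c d * (S (x div d) - L)) \<le> (\<Sum>d=1..x. 2 * B / real x * mangoldt d)"
    proof (rule sum_norm_le)
      fix d assume d: "d \<in> {1..x}"
      have "norm (c d * (S (x div d) - L)) \<le> (1 * mangoldt d / real d) * (2 * B * (real d / real x))"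
        unfolding norm_mult
      proof (rule mult_mono[OF _ S_tail_div[OF d]])
        show "norm (c d) \<le> 1 * mangoldt d / real d"
          unfolding c_def norm_divide norm_mult norm_mangoldt norm_of_nat
          by (intro divide_right_mono mult_right_mono norm_le mangoldt_nonneg) auto
      qed (auto intro!: divide_nonneg_nonneg mangoldt_nonneg)
      also have "\<dots> = 2 * B / real x * mangoldt d" using d by simp
      finally show "norm (c d * (S (x div d) - L)) \<le> 2 * B / real x * mangoldt d" .
    qed
    also have "\<dots> = 2 * B / real x * (\<Sum>d=1..x. mangoldt d)"
      by (simp add: sum_distrib_left)
    also have "\<dots> \<le> 2 * B / real x * (4 * real x)"
      using B_nonneg by (intro mult_left_mono chebyshev_mangoldt) auto
    also have "\<dots> = 8 * B" using False by simp
    finally have "norm (L * K x) \<le> 1 + 2 * B * ln 3 + 8 * B"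
      unfolding eq using sum_ln_bound[of x] norm_triangle_ineq4 by (smt (verit))
    thus ?thesis using assms by (simp add: norm_mult field_simps)
  qed (use B_nonneg in \<open>simp add: K_def\<close>)
  thus ?thesis by blast
qed

text \<open>The dual of the preceding argument, with weights \<open>moebius d * ln (x / d)\<close>:
  the convolution now equals \<open>ln x + K x\<close>. As \<open>L = 0\<close>,
  \<open>S (x div d)\<close> is itself as small as its tail, and the sum of
  \<open>ln (x / d)\<close> over \<open>d \<le> x\<close> is at most \<open>x\<close>.\<close>

lemma K_plus_ln_bounded:
  assumes "L = 0"
  shows "\<exists>C. \<forall>x>0. norm (of_real (ln (real x)) + K x) \<le> C"
proof -
  have "norm (of_real (ln (real x)) + K x) \<le> 2 * B" if x: "x > 0" for x
  proof -
    define c where "c d = chi d * of_real (moebius d * ln (real x / real d)) / of_nat d" for d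
    have "(\<Sum>d=1..x. c d * S (x div d)) = (\<Sum>n=1..x. \<Sum>d | d dvd n. c d * (chi (n div d) / of_nat (n div d)))"
      unfolding S_def sum_distrib_left by (rule sum_divisors_swap [symmetric])
    also have "\<dots> = (\<Sum>n=1..x. chi n / of_nat n * of_real (if n = 1 then ln (real x) else 0)
                                + chi n * mangoldt n / of_nat n)"
    proof (intro sum.cong refl)
      fix n assume n: "n \<in> {1..x}"
      have "(\<Sum>d | d dvd n. c d * (chi (n div d) / of_nat (n div d)))
          = (\<Sum>d | d dvd n. chi n / of_nat n * of_real (moebius d * ln (real x / real d)))"
        using n by (intro sum.cong refl) (subst chi_div, auto simp: c_def)
      also have "\<dots> = chi n / of_nat n * of_real (\<Sum>d | d dvd n. moebius d * ln (real x / real d))"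
        by (simp only: sum_distrib_left of_real_sum)
      also have "(\<Sum>d | d dvd n. moebius d * ln (real x / real d))
                   = (if n = 1 then ln (real x) else 0) + mangoldt n"
        using n x by (intro sum_moebius_ln_divide) auto
      finally show "(\<Sum>d | d dvd n. c d * (chi (n div d) / of_nat (n div d)))
          = chi n / of_nat n * of_real (if n = 1 then ln (real x) else 0) + chi n * mangoldt n / of_nat n"
        by (simp add: algebra_simps)
    qed
    also have "\<dots> = (\<Sum>n=1..x. chi n / of_nat n * of_real (if n = 1 then ln (real x) else 0)) + K x"
      by (simp add: sum.distrib K_def)
    also have "(\<Sum>n=1..x. chi n / of_nat n * of_real (if n = 1 then ln (real x) else 0))
        = (\<Sum>n\<in>{1}. chi n / of_nat n * of_real (if n = 1 then ln (real x) else 0))"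
      using x by (intro sum.mono_neutral_right) auto
    finally have eq: "of_real (ln (real x)) + K x = (\<Sum>d=1..x. c d * S (x div d))"
      using one by simp
    have "norm (\<Sum>d=1..x. c d * S (x div d)) \<le> (\<Sum>d=1..x. 2 * B / real x * ln (real x / real d))"
    proof (rule sum_norm_le)
      fix d assume d: "d \<in> {1..x}"
      have ln: "ln (real x / real d) \<ge> 0" using d by simp
      have "norm (c d * S (x div d)) \<le> (1 * (1 * ln (real x / real d)) / real d) * (2 * B * (real d / real x))"
        unfolding norm_mult
      proof (rule mult_mono)
        show "norm (c d) \<le> 1 * (1 * ln (real x / real d)) / real d"
          unfolding c_def norm_divide norm_mult norm_of_nat norm_of_real abs_mult
          using ln by (intro divide_right_mono mult_mono norm_le abs_moebius_le) auto
        show "norm (S (x div d)) \<le> 2 * B * (real d / real x)"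
          using S_tail_div[OF d] assms by simp
      qed (use ln in auto)
      also have "\<dots> = 2 * B / real x * ln (real x / real d)" using d by simp
      finally show "norm (c d * S (x div d)) \<le> 2 * B / real x * ln (real x / real d)" .
    qed
    also have "\<dots> = 2 * B / real x * (\<Sum>d=1..x. ln (real x / real d))"
      by (simp add: sum_distrib_left)
    also have "(\<Sum>d=1..x. ln (real x / real d)) = (\<Sum>d=1..x. ln (real x) - ln (real d))"
      using x by (intro sum.cong) (auto simp: ln_div)
    also have "\<dots> = real x * ln (real x) - ln (fact x)"
    proof -
      have "(\<Sum>d=1..x. ln (real d)) = ln (\<Prod>d=1..x. real d)"
        by (rule ln_prod [symmetric]) auto
      thus ?thesis by (simp add: sum_subtractf fact_prod)
    qed
    also have "2 * B / real x * (real x * ln (real x) - ln (fact x)) \<le> 2 * B / real x * real x"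
      using ln_fact_ge[of x] B_nonneg by (intro mult_left_mono) auto
    also have "\<dots> = 2 * B" using x by simp
    finally show ?thesis by (simp only: eq)
  qed
  thus ?thesis by blast
qed

end

section \<open>Non-vanishing for real characters\<close>

text \<open>The exponents \<open>i\<close> and \<open>n - 1 - i\<close> are paired and the
  arithmetic-geometric mean inequality is applied to each pair. The base is written as a square to
  keep the exponent \<open>n - 1\<close> integral.\<close>

lemma geometric_sum_ge:
  assumes "x > 0"
  shows "(\<Sum>i<n. (x ^ 2) ^ i) \<ge> real n * x ^ (n - 1)"
proof -
  have "2 * (\<Sum>i<n. (x ^ 2) ^ i) = (\<Sum>i<n. (x ^ 2) ^ i) + (\<Sum>i<n. (x ^ 2) ^ (n - Suc i))"
    by (subst sum.nat_diff_reindex) simp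
  also have "\<dots> = (\<Sum>i<n. (x ^ i) ^ 2 + (x ^ (n - Suc i)) ^ 2)"
    by (simp add: sum.distrib power_mult [symmetric] mult.commute)
  also have "\<dots> \<ge> (\<Sum>i<n. 2 * x ^ (n - 1))"
  proof (rule sum_mono)
    fix i assume i: "i \<in> {..<n}"
    have "x ^ (n - 1) = x ^ i * x ^ (n - Suc i)"
      using i by (simp add: power_add [symmetric])
    thus "2 * x ^ (n - 1) \<le> (x ^ i) ^ 2 + (x ^ (n - Suc i)) ^ 2"
      using sum_squares_bound[of "x ^ i" "x ^ (n - Suc i)"] by simp
  qed
  finally show ?thesis by simp
qed

text \<open>With \<open>1 - x ^ n = (1 - x) * G n\<close> the claim becomes
  \<open>n * (n + 1) * x ^ n \<le> G n * G (n + 1)\<close>. For \<open>x = y ^ 2\<close> the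
  geometric sum bound gives \<open>n * (n + 1) * y ^ (2 * n - 1)\<close> on the right, which exceeds
  what is needed by a factor \<open>1 / y\<close>.\<close>

lemma lambert_weight_decreasing:
  fixes x :: real
  assumes x: "0 < x" "x < 1" and n: "n > 0"
  shows "1 / (real (Suc n) * (1 - x)) - x ^ Suc n / (1 - x ^ Suc n)
       \<le> 1 / (real n * (1 - x)) - x ^ n / (1 - x ^ n)"
proof -
  define G where "G n = (\<Sum>i<n. x ^ i)" for n
  have G: "1 - x ^ n = (1 - x) * G n" for n
    by (simp add: G_def one_diff_power_eq)
  have Gpos: "G n > 0" if "n > 0" for n
    unfolding G_def using that x by (intro sum_pos) auto
  define y where "y = sqrt x"
  have y: "y > 0" "y < 1" "x = y ^ 2" using x by (auto simp: y_def)
  have Gge: "G n \<ge> real n * y ^ (n - 1)" for n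
    using geometric_sum_ge[OF y(1), of n] by (simp add: G_def y(3))
  have "real n * real (Suc n) * x ^ n \<le> real n * real (Suc n) * y ^ (2 * n - 1)"
    unfolding y(3) power_mult [symmetric] using y by (intro mult_left_mono power_decreasing) auto
  also have "y ^ (2 * n - 1) = y ^ (n - 1) * y ^ n"
    using n by (simp add: power_add [symmetric] mult_2)
  also have "real n * real (Suc n) * (y ^ (n - 1) * y ^ n) = (real n * y ^ (n - 1)) * (real (Suc n) * y ^ (Suc n - 1))"
    by simp
  also have "\<dots> \<le> G n * G (Suc n)"
    by (intro mult_mono Gge) (use y Gpos[OF n] in auto)
  finally have GG: "real n * real (Suc n) * x ^ n \<le> G n * G (Suc n)" .
  have "x ^ n / (1 - x ^ n) - x ^ Suc n / (1 - x ^ Suc n) = x ^ n * (1 - x) / ((1 - x ^ n) * (1 - x ^ Suc n))"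
  proof -
    have "1 - x ^ n \<noteq> 0" "1 - x ^ Suc n \<noteq> 0"
      using Gpos[of n] Gpos[of "Suc n"] n x unfolding G by auto
    thus ?thesis by (simp add: divide_simps) (simp add: algebra_simps)
  qed
  also have "\<dots> = (1 / (1 - x)) * (x ^ n / (G n * G (Suc n)))"
    unfolding G using x by simp
  also have "\<dots> \<le> (1 / (1 - x)) * (1 / (real n * real (Suc n)))"
  proof (rule mult_left_mono)
    have *: "t / a \<le> 1 / b" if "a > 0" "b > 0" "b * t \<le> a" for a b t :: real
      using that by (simp add: field_simps)
    have "G n * G (Suc n) > 0" using Gpos[of n] Gpos[of "Suc n"] n by simp
    moreover have "real n * real (Suc n) > 0" using n by simp
    ultimately show "x ^ n / (G n * G (Suc n)) \<le> 1 / (real n * real (Suc n))"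
      using GG by (rule *)
  qed (use x in auto)
  also have "1 / (real n * real (Suc n)) = 1 / real n - 1 / real (Suc n)"
    using n by (simp add: field_simps)
  also have "(1 / (1 - x)) * (1 / real n - 1 / real (Suc n)) = 1 / (real n * (1 - x)) - 1 / (real (Suc n) * (1 - x))"
    by (simp add: algebra_simps)
  finally show ?thesis by simp
qed

lemma lambert_weight_nonneg:
  fixes x :: real
  assumes x: "0 < x" "x < 1" and n: "n > 0"
  shows "0 \<le> 1 / (real n * (1 - x)) - x ^ n / (1 - x ^ n)"
proof -
  have "(\<Sum>i<n. x ^ n) \<le> (\<Sum>i<n. x ^ i)"
    using x by (intro sum_mono power_decreasing) auto
  hence "(1 - x) * (real n * x ^ n) \<le> (1 - x) * (\<Sum>i<n. x ^ i)"
    using x by (intro mult_left_mono) auto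
  also have "\<dots> = 1 - x ^ n" by (simp add: one_diff_power_eq)
  finally have "real n * (1 - x) * x ^ n \<le> 1 - x ^ n" by (simp add: mult_ac)
  moreover have "x ^ n < 1" using x n by (simp add: power_less_one_iff)
  ultimately have "x ^ n / (1 - x ^ n) \<le> 1 / (real n * (1 - x))"
    using x n by (subst pos_divide_le_eq, simp) (simp add: pos_le_divide_eq mult_ac)
  thus ?thesis by simp
qed

text \<open>Cutting the geometric series at \<open>n * k \<le> N\<close> leaves a tail that begins
  at an exponent above \<open>N\<close>. It permits working with finite sums in place of Lambert
  series.\<close>

lemma lambert_term_bound:
  fixes x :: real
  assumes x: "0 < x" "x < 1" and n: "n \<in> {1..N}"
  shows "\<bar>x ^ n / (1 - x ^ n) - (\<Sum>k=1..N div n. x ^ (n * k))\<bar> \<le> x ^ N / (1 - x)"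
proof -
  define K where "K = N div n"
  have xn: "x ^ n < 1" using x n by (auto simp: power_less_one_iff)
  have "(1 - x ^ n) * (\<Sum>k=1..K. x ^ (n * k)) = x ^ n - x ^ (n * Suc K)"
  proof (induction K)
    case (Suc K)
    have *: "(1 - a) * s' = a - u" if "s' = s + t" "u = a * t" "(1 - a) * s = a - t" for a s s' t u :: real
      unfolding that(1,2) distrib_left that(3) by (simp add: algebra_simps)
    have "(\<Sum>k=1..Suc K. x ^ (n * k)) = (\<Sum>k=1..K. x ^ (n * k)) + x ^ (n * Suc K)" by simp
    moreover have "x ^ (n * Suc (Suc K)) = x ^ n * x ^ (n * Suc K)" by (simp add: power_add)
    ultimately show ?case
      using Suc.IH by (rule *)
  qed auto
  hence "(\<Sum>k=1..K. x ^ (n * k)) = (x ^ n - x ^ (n * Suc K)) / (1 - x ^ n)"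
    using xn by (simp add: field_simps)
  hence "x ^ n / (1 - x ^ n) - (\<Sum>k=1..K. x ^ (n * k)) = x ^ (n * Suc K) / (1 - x ^ n)"
    by (simp add: diff_divide_distrib)
  moreover have "x ^ (n * Suc K) / (1 - x ^ n) \<le> x ^ N / (1 - x)"
  proof (rule frac_le)
    have "N < (K + 1) * n" using n dividend_less_div_times[of n N] by (simp add: K_def)
    thus "x ^ (n * Suc K) \<le> x ^ N"
      using x by (intro power_decreasing) (auto simp: mult_ac)
    have "x ^ n \<le> x ^ 1" using x n by (intro power_decreasing) auto
    thus "1 - x \<le> 1 - x ^ n" by simp
  qed (use x in auto)
  moreover have "x ^ (n * Suc K) / (1 - x ^ n) \<ge> 0" using x xn by simp
  ultimately show ?thesis unfolding K_def by linarith
qed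

lemma sum_powers_sign:
  fixes r :: real
  assumes "r \<in> {-1, 0, 1}"
  shows "(\<Sum>i\<le>k. r ^ i) \<ge> 0" "(\<Sum>i\<le>2 * k. r ^ i) \<ge> 1"
proof -
  have m1: "(\<Sum>i\<le>k. (-1::real) ^ i) = (if even k then 1 else 0)" for k
    by (induction k) auto
  have z: "(\<Sum>i\<le>k. (0::real) ^ i) = 1" for k
    by (induction k) auto
  show "(\<Sum>i\<le>k. r ^ i) \<ge> 0" "(\<Sum>i\<le>2 * k. r ^ i) \<ge> 1"
    using assms by (auto simp: m1 z)
qed

text \<open>The divisor sum is a product of local factors, the sums of \<open>r p ^ i\<close> for
  \<open>i\<close> up to the exponent of \<open>p\<close>. None is negative; in a square all
  exponents are even, and then even \<open>r p = -1\<close> leaves a factor 1.\<close>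

lemma divisor_sum_real_character:
  fixes r :: "nat \<Rightarrow> real"
  assumes r1: "r 1 = 1" and mult: "\<And>m n. r (m * n) = r m * r n" and vals: "\<And>n. r n \<in> {-1, 0, 1}"
  shows "n > 0 \<Longrightarrow> (\<Sum>d | d dvd n. r d) \<ge> 0 \<and> (\<Sum>d | d dvd n ^ 2. r d) \<ge> 1"
proof (induction n rule: less_induct)
  case (less n)
  show ?case
  proof (cases "n = 1")
    case True
    thus ?thesis using r1 by simp
  next
    case False
    then obtain p where p: "prime p" "p dvd n" using prime_factor_nat by blast
    obtain m where m: "n = p ^ multiplicity p n * m" "\<not> p dvd m"
      using multiplicity_decompose'[of n p] less.prems p by (metis not_gr_zero not_prime_unit)
    define k where "k = multiplicity p n"
    have k: "k > 0" using p less.prems by (simp add: k_def prime_multiplicity_gt_zero_iff)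
    have m0: "m > 0" using m(2) by (cases "m = 0") auto
    have n_eq: "n = p ^ k * m" using m by (simp add: k_def)
    have "1 < p ^ k" using p(1) k prime_gt_1_nat by (intro one_less_power) auto
    hence "m < n" using m0 by (subst n_eq) simp
    hence IH: "(\<Sum>d | d dvd m. r d) \<ge> 0" "(\<Sum>d | d dvd m ^ 2. r d) \<ge> 1"
      using less.IH[of m] m0 by auto
    have pow: "r (p ^ i) = r p ^ i" for i
      by (induction i) (use r1 mult in auto)
    have split: "(\<Sum>d | d dvd p ^ j * m'. r d) = (\<Sum>i\<le>j. r p ^ i) * (\<Sum>d | d dvd m'. r d)"
      if "\<not> p dvd m'" "m' > 0" for j m'
      using sum_divisors_prime_power_mult[OF p(1) that, of r j]
      by (simp add: mult pow sum_distrib_right [symmetric] sum_distrib_left [symmetric])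
    have "(\<Sum>d | d dvd n. r d) \<ge> 0"
      unfolding n_eq using split[OF m(2) m0, of k] sum_powers_sign(1)[OF vals[of p], of k] IH(1) by simp
    moreover have "n ^ 2 = p ^ (2 * k) * m ^ 2"
      by (simp add: n_eq power_mult_distrib power_mult [symmetric] mult.commute)
    moreover have "\<not> p dvd m ^ 2" using p(1) m(2) prime_dvd_power by blast
    hence "(\<Sum>d | d dvd p ^ (2 * k) * m ^ 2. r d) = (\<Sum>i\<le>2 * k. r p ^ i) * (\<Sum>d | d dvd m ^ 2. r d)"
      using split[of "m ^ 2" "2 * k"] m0 by simp
    moreover have "\<dots> \<ge> 1 * 1"
      using sum_powers_sign(2)[OF vals[of p], of k] IH(2) by (intro mult_mono) auto
    ultimately show ?thesis by simp
  qed
qed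

context oscillating_character
begin

text \<open>
  The sum over squares is at most the Lambert sum of \<open>chi n * x ^ n / (1 - x ^ n)\<close>, whose
  coefficients are the non-negative divisor sums of \<open>chi\<close>. If \<open>L = 0\<close>, subtracting
  \<open>chi n / (n * (1 - x))\<close> termwise costs nothing in the limit and leaves decreasing weights, so
  Abel summation bounds it uniformly in \<open>x\<close>.
\<close>

lemma lambert_sum_bound:
  assumes vals: "\<And>n. chi n \<in> {-1, 0, 1}" and L0: "L = 0"
    and x: "0 < x" "x < 1" and M: "M ^ 2 \<le> N"
  shows "(\<Sum>m=1..M. x ^ (m ^ 2)) \<le> 2 * B + 2 * B / (1 - x) * (1 / real (Suc N)) + (real N * x ^ N) / (1 - x)"
proof -
  define r where "r n = Re (chi n)" for n
  have r_vals: "r n \<in> {-1, 0, 1}" for n using vals[of n] by (auto simp: r_def)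
  have chi_r: "chi n = of_real (r n)" for n using vals[of n] by (auto simp: r_def)
  have r1: "r 1 = 1" using one by (simp add: r_def)
  have r_mult: "r (m * n) = r m * r n" for m n
    using mult[of m n] by (simp add: chi_r flip: of_real_mult)
  have r_sums: "norm (\<Sum>n=1..N. r n) \<le> B" for N
  proof -
    have "(\<Sum>n=1..N. chi n) = of_real (\<Sum>n=1..N. r n)" by (simp add: chi_r)
    thus ?thesis using partial_sums[of N] by (metis norm_of_real real_norm_def)
  qed
  have S_r: "\<bar>\<Sum>n=1..N. r n / real n\<bar> \<le> 2 * B / real (Suc N)"
  proof -
    have "S N = of_real (\<Sum>n=1..N. r n / real n)" by (simp add: S_def chi_r)
    thus ?thesis using S_tail[of N] L0 by (metis diff_zero norm_of_real)
  qed
  define c where "c n = (\<Sum>d | d dvd n. r d)" for n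
  have c: "n > 0 \<Longrightarrow> c n \<ge> 0" "n > 0 \<Longrightarrow> c (n ^ 2) \<ge> 1" for n
    using divisor_sum_real_character[OF r1 r_mult r_vals, of n] by (auto simp: c_def)
  define b where "b n = 1 / (real n * (1 - x)) - x ^ n / (1 - x ^ n)" for n
  have "(\<Sum>m=1..M. x ^ (m ^ 2)) = (\<Sum>n\<in>(\<lambda>m. m ^ 2) ` {1..M}. x ^ n)"
    by (subst sum.reindex) (auto simp: inj_on_def power2_eq_iff_nonneg)
  also have "\<dots> \<le> (\<Sum>n\<in>(\<lambda>m. m ^ 2) ` {1..M}. c n * x ^ n)"
    using c(2) x by (intro sum_mono) (auto intro!: mult_right_mono[of 1, simplified])
  also have "\<dots> \<le> (\<Sum>n=1..N. c n * x ^ n)"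
  proof (rule sum_mono2)
    show "(\<lambda>m. m ^ 2) ` {1..M} \<subseteq> {1..N}"
      using M by (auto intro: order.trans[OF power_mono])
  qed (use c(1) x in auto)
  also have "\<dots> = (\<Sum>n=1..N. \<Sum>d | d dvd n. r d * x ^ (d * (n div d)))"
    by (auto simp: c_def sum_distrib_right intro!: sum.cong)
  also have "\<dots> = (\<Sum>d=1..N. \<Sum>k=1..N div d. r d * x ^ (d * k))"
    by (rule sum_divisors_swap)
  also have "\<dots> = (\<Sum>d=1..N. r d * (\<Sum>k=1..N div d. x ^ (d * k)))"
    by (simp add: sum_distrib_left)
  also have "\<dots> \<le> (\<Sum>d=1..N. r d * (x ^ d / (1 - x ^ d)) + x ^ N / (1 - x))"
  proof (rule sum_mono)
    fix d assume d: "d \<in> {1..N}"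
    have "\<bar>r d * ((\<Sum>k=1..N div d. x ^ (d * k)) - x ^ d / (1 - x ^ d))\<bar>
        \<le> 1 * (x ^ N / (1 - x))"
      unfolding abs_mult using lambert_term_bound[OF x d] r_vals[of d]
      by (intro mult_mono) (auto simp: abs_minus_commute)
    thus "r d * (\<Sum>k=1..N div d. x ^ (d * k)) \<le> r d * (x ^ d / (1 - x ^ d)) + x ^ N / (1 - x)"
      by (simp add: algebra_simps)
  qed
  also have "\<dots> = (\<Sum>d=1..N. r d * (x ^ d / (1 - x ^ d))) + real N * x ^ N / (1 - x)"
    by (simp add: sum.distrib)
  \<comment> \<open>The term split off sums to a partial sum of \<open>L = 0\<close> divided by
    \<open>1 - x\<close>; for fixed \<open>x\<close> it is of order \<open>1 / N\<close>.\<close>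
  also have "(\<Sum>d=1..N. r d * (x ^ d / (1 - x ^ d)))
      = (\<Sum>d=1..N. (r d / real d) * (1 / (1 - x)) - b d *\<^sub>R r d)"
    by (intro sum.cong) (auto simp: b_def algebra_simps)
  also have "\<dots> = (\<Sum>d=1..N. r d / real d) * (1 / (1 - x)) - (\<Sum>d=Suc 0..N. b d *\<^sub>R r d)"
    by (simp only: sum_subtractf sum_distrib_right One_nat_def)
  also have "\<dots> \<le> 2 * B / real (Suc N) * (1 / (1 - x)) + 2 * B * b (Suc 0)"
  proof -
    have "norm (\<Sum>d=Suc 0..N. b d *\<^sub>R r d) \<le> 2 * B * b (Suc 0)"
      using lambert_weight_decreasing[OF x] lambert_weight_nonneg[OF x]
      by (intro abel_summation_bound[OF r_sums]) (auto simp: b_def)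
    moreover have "(\<Sum>d=1..N. r d / real d) * (1 / (1 - x)) \<le> 2 * B / real (Suc N) * (1 / (1 - x))"
      using S_r x by (intro mult_right_mono) auto
    ultimately show ?thesis by simp
  qed
  \<comment> \<open>The uniformity in \<open>x\<close> comes from here: the first weight is
    \<open>1 / (1 - x) - x / (1 - x)\<close>.\<close>
  also have "b (Suc 0) = 1" using x by (simp add: b_def diff_divide_distrib [symmetric])
  finally show ?thesis by (simp add: mult_ac)
qed

text \<open>The order of limits matters: with \<open>x\<close> and \<open>M\<close> fixed,
  \<open>N\<close> tends to infinity and removes both error terms; with \<open>M\<close> fixed,
  \<open>x\<close> tends to 1 from below. The outcome \<open>M \<le> 2 * B\<close> for every
  \<open>M\<close> is absurd.\<close>

lemma L_nonzero_real:
  assumes vals: "\<And>n. chi n \<in> {-1, 0, 1}"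
  shows "L \<noteq> 0"
proof
  assume L0: "L = 0"
  have bound: "(\<Sum>m=1..M. x ^ (m ^ 2)) \<le> 2 * B" if x: "0 < x" "x < 1" for M and x :: real
  proof (rule LIMSEQ_le_const)
    have "(\<lambda>N. real N * x ^ N) \<longlonglongrightarrow> 0"
      using x by (intro powser_times_n_limit_0) auto
    moreover have "(\<lambda>N. 1 / real (Suc N)) \<longlonglongrightarrow> 0"
      using LIMSEQ_inverse_real_of_nat by (simp add: inverse_eq_divide)
    ultimately have "(\<lambda>N. 2 * B + 2 * B / (1 - x) * (1 / real (Suc N)) + (real N * x ^ N) / (1 - x))
        \<longlonglongrightarrow> 2 * B + 2 * B / (1 - x) * 0 + 0 / (1 - x)"
      using x by (intro tendsto_intros) auto
    thus "(\<lambda>N. 2 * B + 2 * B / (1 - x) * (1 / real (Suc N)) + (real N * x ^ N) / (1 - x)) \<longlonglongrightarrow> 2 * B"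
      by simp
    show "\<exists>N0. \<forall>N\<ge>N0. (\<Sum>m=1..M. x ^ (m ^ 2))
        \<le> 2 * B + 2 * B / (1 - x) * (1 / real (Suc N)) + (real N * x ^ N) / (1 - x)"
      using lambert_sum_bound[OF vals L0 x] by blast
  qed
  have "real M \<le> 2 * B" for M
  proof (rule tendsto_upperbound)
    have "((\<lambda>x. \<Sum>m=1..M. x ^ (m ^ 2)) \<longlongrightarrow> (\<Sum>m=1..M. 1 ^ (m ^ 2))) (at_left (1::real))"
      by (intro tendsto_intros)
    thus "((\<lambda>x. \<Sum>m=1..M. x ^ (m ^ 2)) \<longlongrightarrow> real M) (at_left (1::real))" by simp
    show "\<forall>\<^sub>F x in at_left 1. (\<Sum>m=1..M. x ^ (m ^ 2)) \<le> 2 * B"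
      using eventually_at_left_real[OF zero_less_one] by eventually_elim (use bound in auto)
  qed auto
  moreover obtain M :: nat where "real M > 2 * B" using reals_Archimedean2 by blast
  ultimately show False by (meson not_le)
qed

end

section \<open>Dirichlet's theorem for prime moduli\<close>

text \<open>A primitive root turns the characters modulo \<open>p\<close> into powers of a root of
  unity in the discrete logarithm, so orthogonality is a finite geometric sum.\<close>

locale prime_residue_characters =
  fixes p g :: nat
  assumes p: "prime p" and g: "residue_primroot p g"
begin

definition h :: nat where "h = p - 1"

definition \<omega> :: complex where "\<omega> = cis (2 * pi / real h)"

text \<open>The index (discrete logarithm) of \<open>n\<close>; a junk value if \<open>p\<close> divides \<open>n\<close>.\<close>

definition ind :: "nat \<Rightarrow> nat" where "ind n = (SOME i. [g ^ i = n] (mod p))"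

text \<open>For \<open>a < h\<close> these are all Dirichlet characters modulo \<open>p\<close>,
  with \<open>a = 0\<close> the principal one. Only \<open>ind n\<close> modulo \<open>h\<close>
  matters, so the arbitrary choice in \<open>ind\<close> is harmless.\<close>

definition X :: "nat \<Rightarrow> nat \<Rightarrow> complex" where
  "X a n = (if p dvd n then 0 else \<omega> ^ (a * ind n))"

lemma p_gt_1: "p > 1"
  using p by (rule prime_gt_1_nat)

lemma h_pos: "h > 0"
  using p_gt_1 by (simp add: h_def)

lemma ord_g: "ord p g = h"
  using g p by (simp add: residue_primroot_def totient_prime h_def)

lemma coprime_g: "coprime p g"
  using g by (simp add: residue_primroot_def)

lemma not_dvd_g_power: "\<not> p dvd g ^ i"
  using coprime_g p p_gt_1
  by (metis coprime_absorb_left coprime_power_right_iff nat_dvd_1_iff_1 less_irrefl)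

lemma ind: "\<not> p dvd n \<Longrightarrow> [g ^ ind n = n] (mod p)"
proof -
  assume "\<not> p dvd n"
  hence "n mod p \<in> totatives p"
    using p p_gt_1 by (auto simp: totatives_prime mod_greater_zero_iff_not_dvd)
  hence "n mod p \<in> (\<lambda>i. g ^ i mod p) ` {..<totient p}"
    using residue_primroot_is_generator[OF p_gt_1 g] by (simp add: bij_betw_def)
  hence "\<exists>i. [g ^ i = n] (mod p)" by (auto simp: cong_def)
  thus ?thesis unfolding ind_def by (rule someI_ex)
qed

lemma g_power_cong_iff: "[g ^ i = g ^ j] (mod p) \<longleftrightarrow> [i = j] (mod h)"
  using order_divides_expdiff[OF coprime_g] by (simp add: ord_g)

lemma ind_cong:
  assumes "[m = n] (mod p)" "\<not> p dvd m"
  shows "[ind m = ind n] (mod h)"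
proof -
  have "\<not> p dvd n" using assms by (simp add: cong_dvd_iff)
  hence "[g ^ ind m = g ^ ind n] (mod p)"
    using ind assms by (metis cong_sym cong_trans)
  thus ?thesis by (simp add: g_power_cong_iff)
qed

lemma ind_mult:
  assumes "\<not> p dvd m" "\<not> p dvd n"
  shows "[ind (m * n) = ind m + ind n] (mod h)"
proof -
  have "\<not> p dvd m * n" using assms p by (simp add: prime_dvd_mult_iff)
  hence "[g ^ ind (m * n) = m * n] (mod p)" by (rule ind)
  moreover have "[g ^ ind m * g ^ ind n = m * n] (mod p)"
    using assms ind by (intro cong_mult) auto
  ultimately have "[g ^ ind (m * n) = g ^ (ind m + ind n)] (mod p)"
    by (metis cong_sym cong_trans power_add)
  thus ?thesis by (simp add: g_power_cong_iff)
qed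

lemma ind_g_power: "[ind (g ^ i mod p) = i] (mod h)"
proof -
  have "\<not> p dvd g ^ i mod p" using not_dvd_g_power by (simp add: dvd_mod_iff)
  hence "[g ^ ind (g ^ i mod p) = g ^ i] (mod p)"
    using ind[of "g ^ i mod p"] by (simp add: cong_def)
  thus ?thesis by (simp add: g_power_cong_iff)
qed

lemma h_dvd_ind_iff: "\<not> p dvd n \<Longrightarrow> h dvd ind n \<longleftrightarrow> [n = 1] (mod p)"
  using ind[of n] ord_divides[of g "ind n" p] unfolding ord_g
  by (metis cong_sym cong_trans)

lemma omega_power_h: "\<omega> ^ h = 1"
  using h_pos by (simp add: \<omega>_def Complex.DeMoivre)

lemma omega_power_cong: "[k = l] (mod h) \<Longrightarrow> \<omega> ^ k = \<omega> ^ l"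
proof -
  have "\<omega> ^ k = \<omega> ^ (k mod h)" for k
  proof -
    have "\<omega> ^ (h * (k div h) + k mod h) = \<omega> ^ (k mod h)"
      unfolding power_add power_mult omega_power_h by simp
    thus ?thesis by simp
  qed
  thus "[k = l] (mod h) \<Longrightarrow> \<omega> ^ k = \<omega> ^ l" by (metis cong_def)
qed

lemma omega_power_eq_1_iff: "\<omega> ^ k = 1 \<longleftrightarrow> h dvd k"
proof
  assume "\<omega> ^ k = 1"
  hence "\<omega> ^ (k mod h) = \<omega> ^ 0"
    using omega_power_cong[of k "k mod h"] by (simp add: cong_def)
  hence "cis (2 * pi * real (k mod h) / real h) = cis (2 * pi * real 0 / real h)"
    by (simp add: \<omega>_def Complex.DeMoivre mult_ac)
  moreover have "inj_on (\<lambda>k. cis (2 * pi * real k / real h)) {..<h}"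
    using Complex.bij_betw_roots_unity[OF h_pos] by (simp add: bij_betw_def)
  ultimately have "k mod h = 0" using h_pos by (auto simp: inj_on_def)
  thus "h dvd k" by (simp add: mod_eq_0_iff_dvd)
qed (auto elim!: dvdE simp: power_mult omega_power_h)

lemma norm_omega: "norm \<omega> = 1"
  by (simp add: \<omega>_def)

lemma sum_omega_powers: "(\<Sum>a<h. (\<omega> ^ k) ^ a) = (if h dvd k then of_nat h else 0)"
proof (cases "h dvd k")
  case True
  hence "\<omega> ^ k = 1" by (simp add: omega_power_eq_1_iff)
  thus ?thesis using True by simp
next
  case False
  hence "\<omega> ^ k \<noteq> 1" by (simp add: omega_power_eq_1_iff)
  moreover have "(\<omega> ^ k) ^ h = 1"
    by (metis mult.commute omega_power_h power_mult power_one)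
  ultimately show ?thesis using False by (simp add: geometric_sum)
qed

lemma X_one: "X a 1 = 1"
proof -
  have "h dvd ind 1" using p_gt_1 by (subst h_dvd_ind_iff) auto
  hence "\<omega> ^ (a * ind 1) = 1" by (simp add: omega_power_eq_1_iff)
  thus ?thesis using p_gt_1 by (simp add: X_def)
qed

lemma X_mult: "X a (m * n) = X a m * X a n"
proof (cases "p dvd m * n")
  case True
  thus ?thesis using p by (auto simp: X_def prime_dvd_mult_iff)
next
  case False
  hence nd: "\<not> p dvd m" "\<not> p dvd n" using p by (auto simp: prime_dvd_mult_iff)
  have "[a * ind (m * n) = a * (ind m + ind n)] (mod h)"
    by (rule cong_scalar_left) (rule ind_mult[OF nd])
  hence "\<omega> ^ (a * ind (m * n)) = \<omega> ^ (a * (ind m + ind n))"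
    by (rule omega_power_cong)
  thus ?thesis using False nd by (simp add: X_def distrib_left power_add)
qed

lemma norm_X_le: "norm (X a n) \<le> 1"
  by (simp add: X_def norm_power norm_omega)

lemma X_cong: "[m = n] (mod p) \<Longrightarrow> X a m = X a n"
  using cong_dvd_iff[of m n p] ind_cong[of m n]
  by (auto simp: X_def intro!: omega_power_cong cong_scalar_left)

lemma sum_X_period:
  assumes "0 < a" "a < h"
  shows "(\<Sum>n<p. X a n) = 0"
proof -
  have "(\<Sum>n<p. X a n) = (\<Sum>n\<in>totatives p. X a n)"
    using p by (intro sum.mono_neutral_right) (auto simp: totatives_prime X_def)
  also have "\<dots> = (\<Sum>i<totient p. X a (g ^ i mod p))"
    by (rule sum.reindex_bij_betw [symmetric]) (rule residue_primroot_is_generator[OF p_gt_1 g])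
  also have "\<dots> = (\<Sum>i<h. (\<omega> ^ a) ^ i)"
  proof (intro sum.cong)
    fix i
    have "\<not> p dvd g ^ i mod p" using not_dvd_g_power by (simp add: dvd_mod_iff)
    moreover have "\<omega> ^ (a * ind (g ^ i mod p)) = \<omega> ^ (a * i)"
      by (intro omega_power_cong cong_scalar_left ind_g_power)
    ultimately show "X a (g ^ i mod p) = (\<omega> ^ a) ^ i" by (simp add: X_def power_mult)
  qed (use p in \<open>auto simp: totient_prime h_def\<close>)
  also have "\<dots> = 0" using assms by (simp add: sum_omega_powers nat_dvd_not_less)
  finally show ?thesis .
qed

lemma X_partial_sums:
  assumes "0 < a" "a < h"
  shows "norm (\<Sum>n=1..N. X a n) \<le> real p"
proof -
  have "norm (\<Sum>n<N. X a n) \<le> real p" for N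
  proof (induction N rule: less_induct)
    case (less N)
    show ?case
    proof (cases "N < p")
      case True
      have "norm (\<Sum>n<N. X a n) \<le> (\<Sum>n<N. 1)"
        by (intro sum_norm_le norm_X_le)
      thus ?thesis using True by simp
    next
      case False
      \<comment> \<open>A full period sums to 0, so whole periods can be removed until fewer than
        \<open>p\<close> terms remain.\<close>
      have "(\<Sum>n<p + k. X a n) = (\<Sum>n<k. X a n)" for k
      proof (induction k)
        case (Suc k)
        have "X a (p + k) = X a k" by (rule X_cong) (simp add: cong_def)
        thus ?case using Suc by simp
      qed (use sum_X_period[OF assms] in simp)
      from this[of "N - p"] show ?thesis
        using False less.IH[of "N - p"] p_gt_1 by simp
    qed
  qed
  \<comment> \<open>Starting at 0 changes nothing: \<open>p\<close> divides 0, so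
    \<open>X a 0 = 0\<close>.\<close>
  moreover have "(\<Sum>n=1..N. X a n) = (\<Sum>n<Suc N. X a n)"
    by (intro sum.mono_neutral_left) (auto simp: X_def Suc_le_eq)
  ultimately show ?thesis by (simp only:)
qed

lemma oscillating_X: "0 < a \<Longrightarrow> a < h \<Longrightarrow> oscillating_character (X a) (real p)"
  using X_one X_mult norm_X_le X_partial_sums by unfold_locales auto

lemma sum_X: "(\<Sum>a<h. X a n) = (if [n = 1] (mod p) then of_nat h else 0)"
proof (cases "p dvd n")
  case True
  moreover have "\<not> [n = 1] (mod p)"
    using True p_gt_1 by (metis cong_dvd_iff nat_dvd_1_iff_1 less_irrefl)
  ultimately show ?thesis by (simp add: X_def)
next
  case False
  hence "(\<Sum>a<h. X a n) = (\<Sum>a<h. (\<omega> ^ ind n) ^ a)"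
    by (simp add: X_def power_mult [symmetric] mult.commute)
  thus ?thesis using False by (simp add: sum_omega_powers h_dvd_ind_iff)
qed

lemma cnj_X:
  assumes "a \<le> h"
  shows "cnj (X a n) = X (h - a) n"
proof -
  define z where "z = \<omega> ^ (a * ind n)"
  have "z * \<omega> ^ ((h - a) * ind n) = (\<omega> ^ h) ^ ind n"
    using assms by (simp add: z_def power_add [symmetric] power_mult [symmetric] distrib_right [symmetric])
  hence "z * \<omega> ^ ((h - a) * ind n) = z * cnj z"
    using norm_omega by (simp add: omega_power_h complex_norm_square [symmetric] z_def norm_power
        del: complex_cnj_power)
  moreover have "z \<noteq> 0" using norm_omega by (auto simp: z_def)
  ultimately show ?thesis by (simp add: X_def z_def [symmetric])
qed

text \<open>This is the quadratic character: \<omega> to the power \<open>2 * a\<close> is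
  1.\<close>

lemma X_real:
  assumes "2 * a = h"
  shows "X a n \<in> {-1, 0, 1}"
proof (cases "p dvd n")
  case False
  have "(\<omega> ^ (a * ind n)) ^ 2 = (\<omega> ^ (2 * a)) ^ ind n"
    by (simp add: power_mult [symmetric] mult_ac)
  hence "(\<omega> ^ (a * ind n)) ^ 2 = 1" by (simp add: assms omega_power_h)
  thus ?thesis using False by (auto simp: X_def power2_eq_1_iff)
qed (simp add: X_def)

definition K :: "nat \<Rightarrow> nat \<Rightarrow> complex" where "K a x = (\<Sum>n=1..x. X a n * mangoldt n / of_nat n)"

definition L :: "nat \<Rightarrow> complex" where "L a = oscillating_character.L (X a)"

text \<open>Orthogonality of characters: the sum of \<open>X a (b * n)\<close> over \<open>a\<close>
  singles out the \<open>n\<close> in the class inverse to \<open>b\<close>. Twisting by the inverse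
  class takes the place of a conjugate character.\<close>

lemma sum_X_K:
  "(\<Sum>a<h. X a b * K a x) = of_real (real h * (\<Sum>n | n \<in> {1..x} \<and> [b * n = 1] (mod p). mangoldt n / real n))"
proof -
  have "(\<Sum>a<h. X a b * K a x) = (\<Sum>n=1..x. \<Sum>a<h. X a (b * n) * mangoldt n / of_nat n)"
    unfolding K_def sum_distrib_left X_mult by (subst sum.swap) (simp add: mult.assoc)
  also have "\<dots> = (\<Sum>n=1..x. (\<Sum>a<h. X a (b * n)) * (mangoldt n / of_nat n))"
    by (simp add: sum_distrib_right sum_divide_distrib)
  also have "\<dots> = (\<Sum>n=1..x. if [b * n = 1] (mod p) then of_nat h * (mangoldt n / of_nat n) else 0)"
    by (intro sum.cong refl) (simp add: sum_X)
  also have "\<dots> = (\<Sum>n | n \<in> {1..x} \<and> [b * n = 1] (mod p). of_nat h * (mangoldt n / of_nat n))"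
    by (subst sum.inter_filter [symmetric]) auto
  finally show ?thesis by (simp add: sum_distrib_left)
qed

lemma K_bounded: "0 < a \<Longrightarrow> a < h \<Longrightarrow> L a \<noteq> 0 \<Longrightarrow> \<exists>C. \<forall>x. norm (K a x) \<le> C"
  using oscillating_character.K_bounded[OF oscillating_X]
  by (simp add: L_def K_def oscillating_character.K_def[OF oscillating_X])

lemma K_plus_ln_bounded:
  "0 < a \<Longrightarrow> a < h \<Longrightarrow> L a = 0 \<Longrightarrow> \<exists>C. \<forall>x>0. norm (of_real (ln (real x)) + K a x) \<le> C"
  using oscillating_character.K_plus_ln_bounded[OF oscillating_X]
  by (simp add: L_def K_def oscillating_character.K_def[OF oscillating_X])

text \<open>The principal character has unbounded partial sums and falls outside
  \<open>oscillating_character\<close>; its sum is compared with the Mertens sums instead.\<close>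

lemma K_0: "K 0 x = of_real (\<Sum>n | n \<in> {1..x} \<and> \<not> p dvd n. mangoldt n / real n)"
proof -
  have "K 0 x = (\<Sum>n=1..x. if \<not> p dvd n then mangoldt n / of_nat n else 0)"
    unfolding K_def by (intro sum.cong refl) (simp add: X_def)
  also have "\<dots> = (\<Sum>n | n \<in> {1..x} \<and> \<not> p dvd n. mangoldt n / of_nat n)"
    by (subst sum.inter_filter [symmetric]) auto
  finally show ?thesis by simp
qed

lemma K_0_upper: "x > 0 \<Longrightarrow> Re (K 0 x) \<le> ln (real x) + 4"
proof -
  assume x: "x > 0"
  have "Re (K 0 x) \<le> (\<Sum>n=1..x. mangoldt n / real n)"
    unfolding K_0 Re_complex_of_real
    by (intro sum_mono2) (auto intro!: divide_nonneg_nonneg mangoldt_nonneg)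
  thus ?thesis using mertens_upper[OF x] by linarith
qed

text \<open>The terms missing from the full Mertens sum belong to multiples of \<open>p\<close>,
  each of which is \<open>p\<close> itself or not a prime; together they are bounded.\<close>

lemma K_0_lower: "\<exists>C. \<forall>x>0. Re (K 0 x) \<ge> ln (real x) - C"
proof -
  obtain C where C: "\<And>x. (\<Sum>n | n \<in> {1..x} \<and> \<not> prime n. mangoldt n / real n) \<le> C"
    using mangoldt_nonprime_bound by blast
  have "Re (K 0 x) \<ge> ln (real x) - (1 + C + mangoldt p / real p)" if x: "x > 0" for x
  proof -
    have "(\<Sum>n=1..x. mangoldt n / real n)
        \<le> (\<Sum>n\<in>{n. n \<in> {1..x} \<and> \<not> p dvd n} \<union> ({n. n \<in> {1..x} \<and> \<not> prime n} \<union> {p}). mangoldt n / real n)"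
      using p by (intro sum_mono2) (auto intro!: divide_nonneg_nonneg mangoldt_nonneg dest: primes_dvd_imp_eq)
    also have "\<dots> \<le> Re (K 0 x) + ((\<Sum>n | n \<in> {1..x} \<and> \<not> prime n. mangoldt n / real n) + mangoldt p / real p)"
    proof -
      have sub: "sum f (A \<union> B) \<le> sum f A + sum f B"
        if "finite A" "finite B" "\<And>n. f n \<ge> 0" for f :: "nat \<Rightarrow> real" and A B
        using that sum.union_inter[of A B f] sum_nonneg[of "A \<inter> B" f] by simp
      have nn: "mangoldt n / real n \<ge> 0" for n by (intro divide_nonneg_nonneg mangoldt_nonneg) auto
      show ?thesis
        unfolding K_0 Re_complex_of_real
        using sub[of "{n. n \<in> {1..x} \<and> \<not> prime n}" "{p}" "\<lambda>n. mangoldt n / real n", OF _ _ nn]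
        by (intro order.trans[OF sub] add_left_mono nn) auto
    qed
    finally show ?thesis using mertens_lower[OF x] C[of x] by linarith
  qed
  thus ?thesis by blast
qed

lemma L_conj:
  assumes "0 < a" "a < h"
  shows "L (h - a) = cnj (L a)"
proof -
  have a': "0 < h - a" "h - a < h" using assms by auto
  have "oscillating_character.S (X (h - a)) y = cnj (oscillating_character.S (X a) y)" for y
    using assms by (simp add: oscillating_character.S_def[OF oscillating_X[OF a']]
      oscillating_character.S_def[OF oscillating_X[OF assms]] cnj_X)
  hence eq: "oscillating_character.S (X (h - a)) = (\<lambda>y. cnj (oscillating_character.S (X a) y))"
    by blast
  have "oscillating_character.S (X (h - a)) \<longlonglongrightarrow> cnj (L a)"
    unfolding eq L_def
    by (intro tendsto_cnj oscillating_character.S_tendsto[OF oscillating_X[OF assms]])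
  moreover have "oscillating_character.S (X (h - a)) \<longlonglongrightarrow> L (h - a)"
    unfolding L_def by (rule oscillating_character.S_tendsto[OF oscillating_X[OF a']])
  ultimately show ?thesis by (rule LIMSEQ_unique [symmetric])
qed

text \<open>
  Every vanishing \<open>L\<close> contributes \<open>- ln x\<close> to the non-negative sum of \<open>mangoldt n / n\<close> over
  \<open>n \<equiv> 1\<close>, while the principal character contributes only \<open>+ ln x\<close>. So at most one character
  vanishes, and it equals its conjugate, hence is real.
\<close>

lemma L_nonzero:
  assumes a: "0 < a" "a < h"
  shows "L a \<noteq> 0"
proof
  assume La: "L a = 0"
  show False
  proof (cases "2 * a = h")
    case True
    thus False
      using oscillating_character.L_nonzero_real[OF oscillating_X[OF a] X_real[OF True]] La
      by (simp add: L_def)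
  next
    case False
    \<comment> \<open>\<open>- v b\<close> is the coefficient of \<open>ln x\<close> in an upper
      bound for \<open>Re (K b x)\<close>: 1 for the principal character, -1 where \<open>L\<close>
      vanishes, 0 elsewhere.\<close>
    define v :: "nat \<Rightarrow> real" where "v b = (if b = 0 then -1 else if L b = 0 then 1 else 0)" for b
    have "\<exists>C. \<forall>x>0. Re (K b x) \<le> - v b * ln (real x) + C" if b: "b < h" for b
    proof (cases "b = 0")
      case True
      thus ?thesis using K_0_upper by (auto simp: v_def)
    next
      case b0: False
      show ?thesis
      proof (cases "L b = 0")
        case True
        then obtain C where C: "\<And>x. x > 0 \<Longrightarrow> norm (of_real (ln (real x)) + K b x) \<le> C"
          using K_plus_ln_bounded[of b] b b0 by auto
        have "Re (K b x) \<le> - v b * ln (real x) + C" if "x > 0" for x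
          using C[OF that] complex_Re_le_cmod[of "of_real (ln (real x)) + K b x"] True b0
          by (simp add: v_def)
        thus ?thesis by blast
      next
        case False
        then obtain C where C: "\<And>x. norm (K b x) \<le> C"
          using K_bounded[of b] b b0 by auto
        have "Re (K b x) \<le> - v b * ln (real x) + C" for x
          using C[of x] complex_Re_le_cmod[of "K b x"] False b0 by (simp add: v_def)
        thus ?thesis by blast
      qed
    qed
    then obtain C where C: "\<And>b x. b < h \<Longrightarrow> x > 0 \<Longrightarrow> Re (K b x) \<le> - v b * ln (real x) + C b"
      by metis
    have v_sum: "(\<Sum>b<h. v b) \<ge> 1"
    proof -
      have "L (h - a) = 0" using L_conj[OF a] La by simp
      \<comment> \<open>As \<open>2 * a \<noteq> h\<close>, the three indices are distinct and
        contribute -1, 1 and 1.\<close>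
      hence "1 = (\<Sum>b\<in>{0, a, h - a}. v b)" using a La False by (simp add: v_def)
      also have "\<dots> \<le> (\<Sum>b<h. v b)"
        using a by (intro sum_mono2) (auto simp: v_def)
      finally show ?thesis .
    qed
    have "ln (real x) \<le> (\<Sum>b<h. C b)" if x: "x > 0" for x
    proof -
      have "0 \<le> real h * (\<Sum>n | n \<in> {1..x} \<and> [1 * n = 1] (mod p). mangoldt n / real n)"
        by (intro mult_nonneg_nonneg sum_nonneg divide_nonneg_nonneg mangoldt_nonneg) auto
      also have "\<dots> = Re (\<Sum>b<h. X b 1 * K b x)" by (simp only: sum_X_K Re_complex_of_real)
      also have "\<dots> = (\<Sum>b<h. Re (K b x))" using X_one by simp
      also have "\<dots> \<le> (\<Sum>b<h. - v b * ln (real x) + C b)"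
        using C x by (intro sum_mono) auto
      also have "\<dots> = - (\<Sum>b<h. v b) * ln (real x) + (\<Sum>b<h. C b)"
        by (simp only: sum.distrib sum_distrib_right [symmetric] sum_negf)
      also have "\<dots> \<le> - 1 * ln (real x) + (\<Sum>b<h. C b)"
        using v_sum x by (intro add_mono mult_right_mono) auto
      finally show ?thesis by simp
    qed
    moreover obtain x :: nat where x: "real x > exp (\<Sum>b<h. C b)" using reals_Archimedean2 by blast
    hence "x > 0" using order.strict_trans[OF exp_gt_zero x] by simp
    moreover have "ln (real x) > (\<Sum>b<h. C b)"
      using x \<open>x > 0\<close> by (metis exp_less_cancel_iff exp_ln of_nat_0_less_iff)
    ultimately show False by (meson not_le)
  qed
qed

text \<open>Among the \<open>h\<close> characters only the principal one is unbounded, with growth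
  \<open>ln x\<close>; orthogonality divides it by \<open>h\<close>.\<close>

lemma sum_mangoldt_progression_lower:
  assumes b: "\<not> p dvd b"
  shows "\<exists>C. \<forall>x>0. (\<Sum>n | n \<in> {1..x} \<and> [b * n = 1] (mod p). mangoldt n / real n) \<ge> ln (real x) / real h - C"
proof -
  have "\<exists>C. \<forall>x. norm (K a x) \<le> C" if "a \<in> {1..<h}" for a
    using K_bounded[of a] L_nonzero[of a] that by auto
  then obtain C where C: "\<And>a x. a \<in> {1..<h} \<Longrightarrow> norm (K a x) \<le> C a" by metis
  obtain C0 where C0: "\<And>x. x > 0 \<Longrightarrow> Re (K 0 x) \<ge> ln (real x) - C0"
    using K_0_lower by blast
  have "(\<Sum>n | n \<in> {1..x} \<and> [b * n = 1] (mod p). mangoldt n / real n)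
      \<ge> ln (real x) / real h - (C0 + (\<Sum>a=1..<h. C a)) / real h" if x: "x > 0" for x
  proof -
    have "{..<h} = insert 0 {1..<h}" using h_pos by auto
    hence "(\<Sum>a<h. X a b * K a x) = X 0 b * K 0 x + (\<Sum>a=1..<h. X a b * K a x)"
      by simp
    moreover have "X 0 b = 1" using b by (simp add: X_def)
    moreover have "norm (\<Sum>a=1..<h. X a b * K a x) \<le> (\<Sum>a=1..<h. 1 * C a)"
      unfolding norm_mult by (intro sum_norm_le, unfold norm_mult, intro mult_mono norm_X_le C) auto
    ultimately have "Re (\<Sum>a<h. X a b * K a x) \<ge> ln (real x) - C0 - (\<Sum>a=1..<h. C a)"
      using C0[OF x] abs_Re_le_cmod[of "\<Sum>a=1..<h. X a b * K a x"] by simp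
    hence "real h * (\<Sum>n | n \<in> {1..x} \<and> [b * n = 1] (mod p). mangoldt n / real n)
        \<ge> ln (real x) - C0 - (\<Sum>a=1..<h. C a)"
      by (simp only: sum_X_K Re_complex_of_real)
    thus ?thesis using h_pos by (simp add: field_simps)
  qed
  thus ?thesis by blast
qed

end

text \<open>If the reciprocals were summable, a tail of size at most \<open>e\<close> would keep the
  sum of \<open>ln q / q\<close> below \<open>e * ln x\<close> plus a constant, whereas it grows at
  least like \<open>ln x / h\<close>. This takes the place of partial summation.\<close>

theorem dirichlet_prime_modulus_divergence:
  fixes p c :: nat and R :: real
  assumes p: "prime p" and c: "\<not> p dvd c"
  shows "\<exists>N. (\<Sum>q | q \<in> {1..N} \<and> prime q \<and> [q = c] (mod p). 1 / real q) > R"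
proof (rule ccontr)
  assume "\<not> ?thesis"
  hence R: "(\<Sum>q | q \<in> {1..N} \<and> prime q \<and> [q = c] (mod p). 1 / real q) \<le> R" for N
    by (auto simp: not_less)
  obtain g where g: "residue_primroot p g" using prime_primitive_root_exists p prime_gt_1_nat by blast
  interpret prime_residue_characters p g by unfold_locales (use p g in auto)
  obtain b where b: "[c * b = 1] (mod p)"
    using cong_solve_coprime_nat[of c p] c p by (metis coprime_commute prime_imp_coprime One_nat_def)
  hence "\<not> p dvd b" using p_gt_1 
    by (metis cong_dvd_iff dvd_mult nat_dvd_1_iff_1 less_irrefl)
  then obtain C1 where C1: "\<And>x. x > 0 \<Longrightarrow>
      (\<Sum>n | n \<in> {1..x} \<and> [b * n = 1] (mod p). mangoldt n / real n) \<ge> ln (real x) / real h - C1"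
    using sum_mangoldt_progression_lower by blast
  obtain C2 where C2: "\<And>x. (\<Sum>n | n \<in> {1..x} \<and> \<not> prime n. mangoldt n / real n) \<le> C2"
    using mangoldt_nonprime_bound by blast
  define f where "f n = (if prime n \<and> [n = c] (mod p) then 1 / real n else 0)" for n
  have f_nonneg: "f n \<ge> 0" for n by (simp add: f_def)
  have f_sum: "(\<Sum>n=1..N. f n) \<le> R" for N
  proof -
    have "(\<Sum>n=1..N. f n) = (\<Sum>q | q \<in> {1..N} \<and> prime q \<and> [q = c] (mod p). 1 / real q)"
      unfolding f_def by (subst sum.inter_filter [symmetric]) auto
    thus ?thesis using R[of N] by simp
  qed
  have "summable f"
  proof (rule bounded_imp_summable)
    show "(\<Sum>n\<le>N. f n) \<le> R" for N
    proof -
      have "(\<Sum>n\<le>N. f n) = (\<Sum>n=1..N. f n)"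
        by (rule sum.mono_neutral_right) (auto simp: f_def Suc_le_eq)
      thus ?thesis using f_sum by simp
    qed
  qed (rule f_nonneg)
  \<comment> \<open>Half of the growth rate \<open>1 / h\<close>.\<close>
  define e where "e = 1 / (2 * real h)"
  have e: "e > 0" using h_pos by (simp add: e_def)
  have "\<forall>\<^sub>F z in sequentially. (\<Sum>n<z. f n) > suminf f - e"
    using summable_LIMSEQ[OF \<open>summable f\<close>] e by (intro order_tendstoD) auto
  then obtain z where z: "(\<Sum>n<z. f n) > suminf f - e" 
    by (metis eventually_sequentially order_refl)
  define D where "D = (\<Sum>n<z. f n * ln (real n))"
  have ln_nn: "ln (real n) \<ge> 0" for n :: nat by (cases "n = 0") auto
  have upper: "(\<Sum>n=1..x. f n * ln (real n)) \<le> D + e * ln (real x)" for x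
  proof -
    have "(\<Sum>n=1..x. f n * ln (real n)) \<le> (\<Sum>n\<in>{..<z} \<union> {z..x}. f n * ln (real n))"
      by (intro sum_mono2) (auto intro!: mult_nonneg_nonneg f_nonneg ln_nn)
    also have "\<dots> = D + (\<Sum>n=z..x. f n * ln (real n))"
      unfolding D_def by (intro sum.union_disjoint) auto
    also have "(\<Sum>n=z..x. f n * ln (real n)) \<le> (\<Sum>n=z..x. f n * ln (real x))"
    proof (rule sum_mono)
      fix n assume "n \<in> {z..x}"
      thus "f n * ln (real n) \<le> f n * ln (real x)"
      proof (cases "n = 0")
        case False
        thus ?thesis using \<open>n \<in> {z..x}\<close> by (intro mult_left_mono f_nonneg) auto
      qed (simp add: f_def)
    qed
    also have "\<dots> = (\<Sum>n=z..x. f n) * ln (real x)" by (simp add: sum_distrib_right)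
    also have "\<dots> \<le> e * ln (real x)"
    proof (intro mult_right_mono ln_nn)
      have "(\<Sum>n<z. f n) + (\<Sum>n=z..x. f n) = (\<Sum>n\<in>{..<z} \<union> {z..x}. f n)"
        by (intro sum.union_disjoint [symmetric]) auto
      also have "\<dots> \<le> suminf f"
        by (intro sum_le_suminf \<open>summable f\<close>) (auto intro: f_nonneg)
      finally show "(\<Sum>n=z..x. f n) \<le> e" using z by linarith
    qed
    finally show ?thesis by simp
  qed
  have lower: "ln (real x) / real h - C1 - C2 \<le> (\<Sum>n=1..x. f n * ln (real n))" if x: "x > 0" for x
  proof -
    have nn: "mangoldt n / real n \<ge> 0" for n by (intro divide_nonneg_nonneg mangoldt_nonneg) auto
    have "(\<Sum>n | n \<in> {1..x} \<and> [b * n = 1] (mod p). mangoldt n / real n)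
        \<le> (\<Sum>n\<in>{n. n \<in> {1..x} \<and> prime n \<and> [n = c] (mod p)} \<union> {n. n \<in> {1..x} \<and> \<not> prime n}. mangoldt n / real n)"
    proof (intro sum_mono2 nn)
      have "[n = c] (mod p)" if "[b * n = 1] (mod p)" for n
      proof -
        have "[c * (b * n) = c * 1] (mod p)" using that by (rule cong_scalar_left)
        moreover have "[c * b * n = 1 * n] (mod p)" using b by (rule cong_scalar_right)
        ultimately show ?thesis by (metis cong_sym cong_trans mult.assoc mult.left_neutral mult.right_neutral)
      qed
      thus "{n. n \<in> {1..x} \<and> [b * n = 1] (mod p)}
          \<subseteq> {n. n \<in> {1..x} \<and> prime n \<and> [n = c] (mod p)} \<union> {n. n \<in> {1..x} \<and> \<not> prime n}" by blast
    qed auto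
    also have "\<dots> = (\<Sum>n | n \<in> {1..x} \<and> prime n \<and> [n = c] (mod p). mangoldt n / real n)
        + (\<Sum>n | n \<in> {1..x} \<and> \<not> prime n. mangoldt n / real n)"
      by (intro sum.union_disjoint) auto
    also have "(\<Sum>n | n \<in> {1..x} \<and> prime n \<and> [n = c] (mod p). mangoldt n / real n) = (\<Sum>n=1..x. f n * ln (real n))"
      by (subst sum.inter_filter) (auto simp: f_def intro!: sum.cong)
    finally show ?thesis using C1[OF x] C2[of x] by linarith
  qed
  have "ln (real x) \<le> (D + C1 + C2) / e" if x: "x > 0" for x
  proof -
    have "ln (real x) / real h = 2 * e * ln (real x)" by (simp add: e_def)
    hence "e * ln (real x) \<le> D + C1 + C2" using lower[OF x] upper[of x] by simp
    thus ?thesis using e by (simp add: field_simps)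
  qed
  moreover obtain x :: nat where x: "real x > exp ((D + C1 + C2) / e)" using reals_Archimedean2 by blast
  hence "x > 0" using order.strict_trans[OF exp_gt_zero x] by simp
  moreover have "ln (real x) > (D + C1 + C2) / e"
    using x \<open>x > 0\<close> by (metis exp_less_cancel_iff exp_ln of_nat_0_less_iff)
  ultimately show False by (meson not_le)
qed

section \<open>Null sets\<close>

text \<open>The count is eventually at most \<delta> times \<open>N\<close> exactly, without a
  further error, so that the bounds of two sets simply add. The number 0 is never counted, whence
  the restriction to \<open>n > 0\<close> in the comparison lemmas.\<close>

definition density_le :: "nat set \<Rightarrow> real \<Rightarrow> bool" where
  "density_le E \<delta> \<longleftrightarrow> (\<exists>N0. \<forall>N\<ge>N0. real (card ({1..N} \<inter> E)) \<le> \<delta> * real N)"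

definition null_density :: "nat set \<Rightarrow> bool" where
  "null_density E \<longleftrightarrow> (\<forall>\<delta>>0. density_le E \<delta>)"

lemma density_le_Un:
  assumes "density_le E a" "density_le F b"
  shows "density_le (E \<union> F) (a + b)"
proof -
  obtain N1 where N1: "\<And>N. N \<ge> N1 \<Longrightarrow> real (card ({1..N} \<inter> E)) \<le> a * real N"
    using assms(1) by (auto simp: density_le_def)
  obtain N2 where N2: "\<And>N. N \<ge> N2 \<Longrightarrow> real (card ({1..N} \<inter> F)) \<le> b * real N"
    using assms(2) by (auto simp: density_le_def)
  have "real (card ({1..N} \<inter> (E \<union> F))) \<le> (a + b) * real N" if "N \<ge> max N1 N2" for N
  proof -
    have "card ({1..N} \<inter> (E \<union> F)) \<le> card ({1..N} \<inter> E) + card ({1..N} \<inter> F)"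
      by (simp add: Int_Un_distrib card_Un_le)
    hence "real (card ({1..N} \<inter> (E \<union> F))) \<le> real (card ({1..N} \<inter> E)) + real (card ({1..N} \<inter> F))"
      by linarith
    thus ?thesis using N1[of N] N2[of N] that by (simp add: algebra_simps)
  qed
  thus ?thesis unfolding density_le_def by blast
qed

lemma density_le_subset:
  assumes "density_le F b" "\<And>n. n > 0 \<Longrightarrow> n \<in> E \<Longrightarrow> n \<in> F" "b \<le> a"
  shows "density_le E a"
proof -
  obtain N2 where N2: "\<And>N. N \<ge> N2 \<Longrightarrow> real (card ({1..N} \<inter> F)) \<le> b * real N"
    using assms(1) by (auto simp: density_le_def)
  have "real (card ({1..N} \<inter> E)) \<le> a * real N" if "N \<ge> N2" for N
  proof -
    have "card ({1..N} \<inter> E) \<le> card ({1..N} \<inter> F)"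
      using assms(2) by (intro card_mono) auto
    hence "real (card ({1..N} \<inter> E)) \<le> real (card ({1..N} \<inter> F))" by simp
    also have "\<dots> \<le> b * real N" using N2 that by simp
    also have "\<dots> \<le> a * real N" using assms(3) by (intro mult_right_mono) auto
    finally show ?thesis .
  qed
  thus ?thesis unfolding density_le_def by blast
qed

lemma null_density_subset:
  "null_density F \<Longrightarrow> (\<And>n. n > 0 \<Longrightarrow> n \<in> E \<Longrightarrow> n \<in> F) \<Longrightarrow> null_density E"
  unfolding null_density_def using density_le_subset by blast

lemma null_density_empty: "null_density {}"
  by (auto simp: null_density_def density_le_def)

lemma null_density_Un: "null_density E \<Longrightarrow> null_density F \<Longrightarrow> null_density (E \<union> F)"
  unfolding null_density_def
proof (intro allI impI)
  fix \<delta> :: real assume "\<forall>\<delta>>0. density_le E \<delta>" "\<forall>\<delta>>0. density_le F \<delta>" "\<delta> > 0"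
  thus "density_le (E \<union> F) \<delta>" using density_le_Un[of E "\<delta> / 2" F "\<delta> / 2"] by simp
qed

lemma null_density_UN: "finite I \<Longrightarrow> (\<And>i. i \<in> I \<Longrightarrow> null_density (E i)) \<Longrightarrow> null_density (\<Union>i\<in>I. E i)"
  by (induction I rule: finite_induct) (auto intro: null_density_Un null_density_empty)

lemma null_densityI:
  assumes "\<And>\<delta>. \<delta> > 0 \<Longrightarrow> \<exists>E' D. null_density E' \<and> density_le D \<delta> \<and> E \<subseteq> E' \<union> D"
  shows "null_density E"
  unfolding null_density_def
proof (intro allI impI)
  fix \<delta> :: real assume "\<delta> > 0"
  then obtain E' D where "null_density E'" "density_le D (\<delta> / 2)" "E \<subseteq> E' \<union> D"
    using assms[of "\<delta> / 2"] by auto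
  moreover have "density_le E' (\<delta> / 2)" using \<open>null_density E'\<close> \<open>\<delta> > 0\<close> by (simp add: null_density_def)
  ultimately show "density_le E \<delta>"
    using density_le_Un[of E' "\<delta> / 2" D "\<delta> / 2"] by (auto intro: density_le_subset)
qed

lemma has_asymptotic_density_1:
  assumes "null_density (- A)"
  shows "has_asymptotic_density A 1"
  unfolding has_asymptotic_density_def
proof (rule order_tendstoI)
  have set_eq: "{n \<in> A. 0 < n \<and> real n \<le> x} = {1..nat \<lfloor>x\<rfloor>} \<inter> A" if "x > 0" for x
  proof (intro equalityI subsetI)
    fix n assume "n \<in> {n \<in> A. 0 < n \<and> real n \<le> x}"
    thus "n \<in> {1..nat \<lfloor>x\<rfloor>} \<inter> A" using le_nat_floor by auto
  next
    fix n assume n: "n \<in> {1..nat \<lfloor>x\<rfloor>} \<inter> A"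
    hence "real n \<le> real (nat \<lfloor>x\<rfloor>)" by simp
    also have "\<dots> \<le> x" using that by simp
    finally show "n \<in> {n \<in> A. 0 < n \<and> real n \<le> x}" using n by simp
  qed
  {
    fix b :: real assume "1 < b"
    have "real (card {n \<in> A. 0 < n \<and> real n \<le> x}) / x < b" if x: "x > 0" for x
    proof -
      have "card ({1..nat \<lfloor>x\<rfloor>} \<inter> A) \<le> card {1..nat \<lfloor>x\<rfloor>}" by (intro card_mono) auto
      hence "real (card ({1..nat \<lfloor>x\<rfloor>} \<inter> A)) \<le> real (nat \<lfloor>x\<rfloor>)" by simp
      also have "\<dots> \<le> x" using x by simp
      finally have "real (card {n \<in> A. 0 < n \<and> real n \<le> x}) / x \<le> 1" using x by (simp add: set_eq)
      thus ?thesis using \<open>1 < b\<close> by linarith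
    qed
    thus "\<forall>\<^sub>F x in at_top. real (card {n \<in> A. 0 < n \<and> real n \<le> x}) / x < b"
      using eventually_gt_at_top[of 0] by (rule eventually_mono[rotated])
  next
    fix a :: real assume a: "a < 1"
    \<comment> \<open>One \<delta> of the gap \<open>1 - a\<close> pays for the exceptional set, the
      other for the loss of 1 in rounding \<open>x\<close> down.\<close>
    define \<delta> where "\<delta> = (1 - a) / 2"
    have \<delta>: "\<delta> > 0" "a = 1 - 2 * \<delta>" using a by (auto simp: \<delta>_def field_simps)
    obtain N0 where N0: "\<And>N. N \<ge> N0 \<Longrightarrow> real (card ({1..N} \<inter> - A)) \<le> \<delta> * real N"
      using assms \<delta>(1) unfolding null_density_def density_le_def by blast
    have "real (card {n \<in> A. 0 < n \<and> real n \<le> x}) / x > a" if x: "x > max (real N0 + 1) (1 / \<delta>)" for x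
    proof -
      define N where "N = nat \<lfloor>x\<rfloor>"
      have xpos: "x > 0" using x \<delta> by linarith
      have N: "real N \<le> x" "real N > x - 1" using xpos unfolding N_def by linarith+
      have "N \<ge> N0" using x N by linarith
      have "card ({1..N} \<inter> A) + card ({1..N} \<inter> - A) = card (({1..N} \<inter> A) \<union> ({1..N} \<inter> - A))"
        by (intro card_Un_disjoint [symmetric]) auto
      also have "({1..N} \<inter> A) \<union> ({1..N} \<inter> - A) = {1..N}" by auto
      finally have "real (card ({1..N} \<inter> A)) + real (card ({1..N} \<inter> - A)) = real N"
        by (metis card_atLeastAtMost diff_Suc_1 of_nat_add)
      hence "real (card ({1..N} \<inter> A)) \<ge> real N - \<delta> * real N"
        using N0[OF \<open>N \<ge> N0\<close>] by linarith
      moreover have "\<delta> * real N \<le> \<delta> * x" using N \<delta> by (intro mult_left_mono) auto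
      ultimately have "real (card ({1..N} \<inter> A)) > x - 1 - \<delta> * x" using N by linarith
      moreover have "1 < \<delta> * x" using x \<delta> by (simp add: field_simps)
      moreover have "a * x = x - 2 * (\<delta> * x)" unfolding \<delta>(2) by (simp add: algebra_simps)
      ultimately have "real (card ({1..N} \<inter> A)) > a * x" by linarith
      thus ?thesis using xpos by (simp add: set_eq N_def field_simps)
    qed
    thus "\<forall>\<^sub>F x in at_top. a < real (card {n \<in> A. 0 < n \<and> real n \<le> x}) / x"
      using eventually_gt_at_top[of "max (real N0 + 1) (1 / \<delta>)"] by (rule eventually_mono[rotated]) auto
  }
qed

text \<open>The tolerance drops to the next value only beyond a threshold past which the exceptions
  to that value are known to be rare. As it never increases again, monotonicity makes every
  exception \<open>n \<le> N\<close> past the initial segment an exception for the tolerance at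
  \<open>N\<close>, so one count bounds them all.\<close>

lemma almost_all_diagonal:
  fixes Q :: "real \<Rightarrow> nat \<Rightarrow> bool"
  assumes null: "\<And>\<epsilon>. \<epsilon> > 0 \<Longrightarrow> null_density {n. \<not> Q \<epsilon> n}"
    and mono: "\<And>\<epsilon> \<epsilon>' n. \<epsilon> \<le> \<epsilon>' \<Longrightarrow> Q \<epsilon> n \<Longrightarrow> Q \<epsilon>' n"
  shows "\<exists>A \<xi>. A \<subseteq> {n. n > 0} \<and> has_asymptotic_density A 1 \<and>
    (\<xi> \<longlongrightarrow> 0) (inf at_top (principal A)) \<and> (\<forall>n\<in>A. Q (\<xi> n) n)"
proof -
  define \<epsilon> where "\<epsilon> m = 1 / real (Suc m)" for m
  have "\<exists>N0. \<forall>N\<ge>N0. real (card ({1..N} \<inter> {n. \<not> Q (\<epsilon> m) n})) \<le> \<epsilon> m * real N" for m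
  proof -
    have "\<epsilon> m > 0" by (simp add: \<epsilon>_def)
    thus ?thesis using null[of "\<epsilon> m"] unfolding null_density_def density_le_def by blast
  qed
  then obtain y where y: "\<And>m N. N \<ge> y m \<Longrightarrow> real (card ({1..N} \<inter> {n. \<not> Q (\<epsilon> m) n})) \<le> \<epsilon> m * real N"
    by metis
  \<comment> \<open>The sum dominates the threshold \<open>y m\<close>; the summand \<open>m\<close>
    leaves only finitely many \<open>m\<close> with \<open>x m \<le> n\<close>.\<close>
  define x where "x m = m + (\<Sum>i\<le>m. y i)" for m
  have x_ge: "x m \<ge> m" "x m \<ge> y m" for m
    using member_le_sum[of m "{..m}" y] by (auto simp: x_def)
  define M where "M n = Max {m. x m \<le> n}" for n
  have fin: "finite {m. x m \<le> n}" for n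
  proof (rule finite_subset)
    show "{m. x m \<le> n} \<subseteq> {..n}"
    proof
      fix m assume "m \<in> {m. x m \<le> n}"
      thus "m \<in> {..n}" using x_ge(1)[of m] by simp
    qed
  qed simp
  have M_ge: "m \<le> M n" if "x m \<le> n" for m n
    unfolding M_def using fin that by (intro Max_ge) auto
  have M_in: "x (M n) \<le> n" if "x 0 \<le> n" for n
  proof -
    have "M n \<in> {m. x m \<le> n}" unfolding M_def using fin that by (intro Max_in) auto
    thus ?thesis by simp
  qed
  define \<xi> where "\<xi> n = \<epsilon> (M n)" for n
  define A where "A = {n. n > 0 \<and> x 0 \<le> n \<and> Q (\<xi> n) n}"
  have \<epsilon>_small: "\<exists>m. \<epsilon> m < d" if "d > 0" for d
    unfolding \<epsilon>_def by (rule nat_approx_posE[OF that]) (rule exI)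
  have \<epsilon>_mono: "\<epsilon> m' \<le> \<epsilon> m" if "m \<le> m'" for m m'
    using that by (auto simp: \<epsilon>_def intro!: divide_left_mono)
  have \<epsilon>_pos: "\<epsilon> m > 0" for m by (simp add: \<epsilon>_def)
  have "(\<xi> \<longlongrightarrow> 0) at_top"
  proof (rule order_tendstoI)
    fix a :: real assume "a < 0"
    hence "a < \<xi> n" for n using \<epsilon>_pos[of "M n"] by (simp add: \<xi>_def)
    thus "\<forall>\<^sub>F n in at_top. a < \<xi> n" by simp
  next
    fix a :: real assume "0 < a"
    then obtain m where m: "\<epsilon> m < a" using \<epsilon>_small by blast
    show "\<forall>\<^sub>F n in at_top. \<xi> n < a"
      using eventually_ge_at_top[of "x m"]
    proof eventually_elim
      case (elim n)
      thus ?case using \<epsilon>_mono[OF M_ge[OF elim]] m by (simp add: \<xi>_def)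
    qed
  qed
  hence lim: "(\<xi> \<longlongrightarrow> 0) (inf at_top (principal A))"
    by (rule tendsto_mono[rotated]) simp
  have "null_density (- A)"
    unfolding null_density_def density_le_def
  proof (intro allI impI)
    fix \<delta> :: real assume \<delta>: "\<delta> > 0"
    then obtain m where m: "\<epsilon> m < \<delta> / 2" using \<epsilon>_small[of "\<delta> / 2"] by auto
    obtain N1 :: nat where N1: "real N1 > real (x 0) * 2 / \<delta>" using reals_Archimedean2 by blast
    show "\<exists>N0. \<forall>N\<ge>N0. real (card ({1..N} \<inter> - A)) \<le> \<delta> * real N"
    proof (intro exI allI impI)
      fix N assume N: "N \<ge> max (x 0) (max (x m) N1)"
      have x0N: "x 0 \<le> N" using N by simp
      have sub: "{1..N} \<inter> - A \<subseteq> {..<x 0} \<union> ({1..N} \<inter> {n. \<not> Q (\<xi> N) n})"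
      proof
        fix n assume n: "n \<in> {1..N} \<inter> - A"
        show "n \<in> {..<x 0} \<union> ({1..N} \<inter> {n. \<not> Q (\<xi> N) n})"
        proof (cases "n < x 0")
          case False
          hence "\<not> Q (\<xi> n) n" using n by (auto simp: A_def)
          moreover have "M n \<le> M N"
            by (intro M_ge order.trans[OF M_in]) (use False n in auto)
          hence "\<xi> N \<le> \<xi> n" by (simp add: \<xi>_def \<epsilon>_mono)
          ultimately have "\<not> Q (\<xi> N) n" using mono[of "\<xi> N" "\<xi> n" n] by blast
          thus ?thesis using n by simp
        qed simp
      qed
      have "card ({1..N} \<inter> - A) \<le> card ({..<x 0} \<union> ({1..N} \<inter> {n. \<not> Q (\<xi> N) n}))"
        by (rule card_mono[OF _ sub]) auto
      also have "\<dots> \<le> x 0 + card ({1..N} \<inter> {n. \<not> Q (\<xi> N) n})"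
        using card_Un_le[of "{..<x 0}"] by simp
      finally have "real (card ({1..N} \<inter> - A)) \<le> real (x 0) + real (card ({1..N} \<inter> {n. \<not> Q (\<xi> N) n}))"
        by linarith
      moreover have "real (card ({1..N} \<inter> {n. \<not> Q (\<xi> N) n})) \<le> \<xi> N * real N"
        unfolding \<xi>_def by (rule y) (rule order.trans[OF x_ge(2) M_in[OF x0N]])
      moreover have "\<xi> N * real N \<le> \<delta> / 2 * real N"
      proof (rule mult_right_mono)
        have "\<xi> N \<le> \<epsilon> m" unfolding \<xi>_def using N by (intro \<epsilon>_mono M_ge) auto
        thus "\<xi> N \<le> \<delta> / 2" using m by linarith
      qed auto
      moreover have "real (x 0) \<le> \<delta> / 2 * real N"
      proof -
        have "real (x 0) * 2 / \<delta> < real N" using N1 N by linarith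
        thus ?thesis using \<delta> by (simp add: field_simps)
      qed
      ultimately show "real (card ({1..N} \<inter> - A)) \<le> \<delta> * real N" by linarith
    qed
  qed
  hence dens: "has_asymptotic_density A 1" by (rule has_asymptotic_density_1)
  have "A \<subseteq> {n. n > 0}" "\<forall>n\<in>A. Q (\<xi> n) n" by (auto simp: A_def)
  thus ?thesis using dens lim by (intro exI[of _ A] exI[of _ \<xi>] conjI)
qed

section \<open>Sieving by primes congruent to -1\<close>

text \<open>Legendre's sieve, one prime at a time: the multiples of \<open>q\<close> among the
  survivors are \<open>q\<close> times the survivors up to \<open>N div q\<close>. An error bound
  \<open>E \<ge> 1\<close> thus becomes \<open>2 * E + 1\<close>, at most \<open>3 * E\<close>.
  Exponential growth in \<open>card S\<close> is harmless since \<open>S\<close> is fixed while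
  \<open>N\<close> grows.\<close>

lemma sieve_count:
  assumes "finite S" "\<And>q. q \<in> S \<Longrightarrow> prime q"
  shows "\<bar>real (card ({1..N} \<inter> {n. \<forall>q\<in>S. \<not> q dvd n})) - real N * (\<Prod>q\<in>S. 1 - 1 / real q)\<bar> \<le> 3 ^ card S"
  using assms
proof (induction S arbitrary: N rule: finite_induct)
  case (insert q S)
  define A where "A N = {1..N} \<inter> {n. \<forall>q\<in>S. \<not> q dvd n}" for N
  define P where "P = (\<Prod>q\<in>S. 1 - 1 / real q)"
  have q: "prime q" "q > 0" using insert.prems prime_gt_0_nat by auto
  have P: "0 \<le> P" "P \<le> 1"
    unfolding P_def using insert.prems prime_gt_0_nat
    by (auto intro!: prod_nonneg prod_le_1 simp: Suc_le_eq)
  have IH: "\<bar>real (card (A N)) - real N * P\<bar> \<le> 3 ^ card S" for N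
    using insert.IH[of N] insert.prems by (simp add: A_def P_def)
  define B where "B = {1..N} \<inter> {n. \<forall>q\<in>insert q S. \<not> q dvd n}"
  have dvd_iff: "q' dvd q * m \<longleftrightarrow> q' dvd m" if "q' \<in> S" for q' m
  proof -
    have "prime q'" "q' \<noteq> q" using insert that by auto
    hence "\<not> q' dvd q" using q(1) primes_dvd_imp_eq by blast
    thus ?thesis using \<open>prime q'\<close> by (simp add: prime_dvd_mult_iff)
  qed
  have A_mult: "q * m \<in> A N \<longleftrightarrow> m \<in> A (N div q)" for m
  proof -
    have "q * m \<le> N \<longleftrightarrow> m \<le> N div q"
      using q(2) by (simp add: less_eq_div_iff_mult_less_eq mult.commute)
    thus ?thesis using dvd_iff q(2) by (auto simp: A_def Suc_le_eq)
  qed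
  have "A N \<inter> {n. q dvd n} = (*) q ` A (N div q)"
    using A_mult by (auto elim!: dvdE)
  moreover have "A N - {n. q dvd n} = B" by (auto simp: A_def B_def)
  moreover have "card (A N) = card (A N - {n. q dvd n}) + card (A N \<inter> {n. q dvd n})"
    by (subst card_Un_disjoint [symmetric]) (auto simp: A_def intro!: arg_cong[of _ _ card])
  ultimately have "card (A N) = card B + card ((*) q ` A (N div q))" by simp
  also have "card ((*) q ` A (N div q)) = card (A (N div q))"
    using q by (intro card_image) (auto simp: inj_on_def)
  finally have card_eq: "real (card B) = real (card (A N)) - real (card (A (N div q)))" by linarith
  have prod_eq: "(\<Prod>q\<in>insert q S. 1 - 1 / real q) = (1 - 1 / real q) * P"
    using insert.hyps by (simp add: P_def)
  have "N < (N div q + 1) * q" using q dividend_less_div_times[of q N] by simp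
  hence "real N < real ((N div q + 1) * q)" by (subst of_nat_less_iff)
  hence "real N / real q < real (N div q) + 1" using q by (simp add: field_simps)
  moreover have "real (N div q) \<le> real N / real q" by (rule of_nat_div_le_of_nat)
  ultimately have "\<bar>real N / real q - real (N div q)\<bar> * P \<le> 1 * 1" using P by (intro mult_mono) auto
  hence 1: "\<bar>(real N / real q - real (N div q)) * P\<bar> \<le> 1" using P by (simp add: abs_mult)
  have "real (card B) - real N * (\<Prod>q\<in>insert q S. 1 - 1 / real q)
      = (real (card (A N)) - real N * P) - (real (card (A (N div q))) - real (N div q) * P)
        + (real N / real q - real (N div q)) * P"
    unfolding card_eq prod_eq by (simp add: algebra_simps)
  moreover have "(3::real) ^ card (insert q S) = 3 * 3 ^ card S" "(1::real) \<le> 3 ^ card S"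
    using insert.hyps by auto
  ultimately show ?case using IH[of N] IH[of "N div q"] 1 unfolding B_def [symmetric] by linarith
qed simp

lemma sieve_density:
  assumes p: "prime p" and \<delta>: "\<delta> > 0"
  obtains S where "finite S" "\<And>q. q \<in> S \<Longrightarrow> prime q \<and> p dvd q + 1"
    "density_le {n. \<forall>q\<in>S. \<not> q dvd n} \<delta>"
proof -
  have p1: "p > 1" using p by (rule prime_gt_1_nat)
  have "\<not> p dvd p - 1" using p1 by (simp add: nat_dvd_not_less)
  \<comment> \<open>The residue \<open>p - 1\<close> is -1 modulo \<open>p\<close>. By
    \<open>1 - t \<le> exp (- t)\<close> this threshold makes the sieve product at most \<delta>/2;
    the other half absorbs the sieve error.\<close>
  then obtain N where N: "(\<Sum>q | q \<in> {1..N} \<and> prime q \<and> [q = p - 1] (mod p). 1 / real q) > ln (2 / \<delta>)"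
    using dirichlet_prime_modulus_divergence[OF p] by blast
  define S where "S = {q. q \<in> {1..N} \<and> prime q \<and> [q = p - 1] (mod p)}"
  have S: "finite S" "\<And>q. q \<in> S \<Longrightarrow> prime q" by (auto simp: S_def)
  have dvd: "p dvd q + 1" if "q \<in> S" for q
  proof -
    have "[q + 1 = (p - 1) + 1] (mod p)" using that by (intro cong_add) (auto simp: S_def)
    thus ?thesis using p1 by (simp add: cong_dvd_iff)
  qed
  have "(\<Prod>q\<in>S. 1 - 1 / real q) \<le> (\<Prod>q\<in>S. exp (- (1 / real q)))"
  proof (intro prod_mono conjI)
    fix q assume "q \<in> S"
    thus "0 \<le> 1 - 1 / real q" using S(2) prime_gt_0_nat[of q] by (simp add: Suc_le_eq)
    show "1 - 1 / real q \<le> exp (- (1 / real q))" using exp_ge_add_one_self[of "- (1 / real q)"] by simp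
  qed
  also have "\<dots> = exp (- (\<Sum>q\<in>S. 1 / real q))"
    using S(1) by (simp add: exp_sum flip: sum_negf)
  also have "\<dots> \<le> exp (- ln (2 / \<delta>))" using N by (simp add: S_def)
  also have "\<dots> = \<delta> / 2" using \<delta> by (simp add: exp_minus)
  finally have prod: "(\<Prod>q\<in>S. 1 - 1 / real q) \<le> \<delta> / 2" .
  obtain N1 :: nat where N1: "real N1 > 3 ^ card S * 2 / \<delta>" using reals_Archimedean2 by blast
  have "real (card ({1..n} \<inter> {n. \<forall>q\<in>S. \<not> q dvd n})) \<le> \<delta> * real n" if "n \<ge> N1" for n
  proof -
    have "3 ^ card S * 2 / \<delta> < real n" using that N1 by linarith
    hence "3 ^ card S \<le> \<delta> / 2 * real n" using \<delta> by (simp add: field_simps)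
    moreover have "real n * (\<Prod>q\<in>S. 1 - 1 / real q) \<le> real n * (\<delta> / 2)"
      by (intro mult_left_mono prod) auto
    ultimately show ?thesis using sieve_count[OF S, of n] by (simp add: algebra_simps)
  qed
  hence "density_le {n. \<forall>q\<in>S. \<not> q dvd n} \<delta>" unfolding density_le_def by blast
  thus ?thesis using that S dvd by blast
qed

section \<open>The function T\<close>

lemma dedekind_T_ratio:
  assumes "n > 0"
  shows "real (dedekind_T n) / real n = (\<Prod>p\<in>prime_factors n. 1 + 1 / real p) - 1"
  using assms by (simp add: real_dedekind_T dedekind_psi_def field_simps)

lemma dedekind_T_ratio_ge:
  assumes "n > 0" "prime q" "q dvd n"
  shows "real (dedekind_T n) / real n \<ge> 1 / real q"
proof -
  have "q \<in> prime_factors n" using assms by (simp add: in_prime_factors_iff)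
  hence "(\<Prod>p\<in>{q}. 1 + 1 / real p) \<le> (\<Prod>p\<in>prime_factors n. 1 + 1 / real p)"
    by (intro prod_mono2) auto
  thus ?thesis using assms by (simp add: dedekind_T_ratio)
qed

lemma dedekind_T_pos:
  assumes "n > 1"
  shows "dedekind_T n > 0"
proof -
  obtain q where q: "prime q" "q dvd n" using assms prime_factor_nat[of n] by auto
  have "0 < 1 / real q" using q prime_gt_0_nat by simp
  also have "\<dots> \<le> real (dedekind_T n) / real n" using assms q by (intro dedekind_T_ratio_ge) auto
  finally show ?thesis by (cases "dedekind_T n = 0") auto
qed

text \<open>\<psi>(n) is \<open>n\<close> divided by its radical, times the product of
  \<open>p + 1\<close> over the primes \<open>p\<close> dividing \<open>n\<close>. The sum
  \<open>dedekind_T n + n\<close> is \<psi>(n) as a natural number.\<close>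

lemma prime_Suc_dvd_dedekind_psi:
  assumes "n > 0" "prime q" "q dvd n"
  shows "q + 1 dvd dedekind_T n + n"
proof -
  let ?P = "prime_factors n"
  have "\<Prod>?P dvd (\<Prod>p\<in>?P. p ^ multiplicity p n)"
  proof (rule prod_dvd_prod)
    fix p assume "p \<in> ?P"
    hence "multiplicity p n > 0" by (simp add: prime_factors_multiplicity)
    thus "p dvd p ^ multiplicity p n" by (simp add: dvd_power)
  qed
  also have "(\<Prod>p\<in>?P. p ^ multiplicity p n) = n"
    using assms by (simp add: prod_prime_factors)
  finally obtain m where m: "n = \<Prod>?P * m" by (elim dvdE)
  have "real (dedekind_T n + n) = dedekind_psi n" by (simp add: real_dedekind_T)
  also have "\<dots> = real m * ((\<Prod>p\<in>?P. real p) * (\<Prod>p\<in>?P. 1 + 1 / real p))"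
    unfolding dedekind_psi_def by (subst (1) m) (simp add: mult_ac)
  also have "(\<Prod>p\<in>?P. real p) * (\<Prod>p\<in>?P. 1 + 1 / real p) = (\<Prod>p\<in>?P. real (p + 1))"
    unfolding prod.distrib [symmetric]
    by (rule prod.cong) (auto simp: in_prime_factors_iff field_simps dest: prime_gt_0_nat)
  also have "real m * \<dots> = real (m * (\<Prod>p\<in>?P. p + 1))" by simp
  finally have "dedekind_T n + n = m * (\<Prod>p\<in>?P. p + 1)" by (simp only: of_nat_eq_iff)
  moreover have "q + 1 dvd (\<Prod>p\<in>?P. p + 1)"
    using assms by (intro dvd_prodI[of ?P q "\<lambda>p. p + 1"]) (auto simp: in_prime_factors_iff)
  ultimately show ?thesis by simp
qed

text \<open>
  The prime \<open>q\<close> with \<open>q \<equiv> -1\<close> modulo \<open>p\<close> is itself propagated along the orbit by the induction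
  hypothesis; this is what makes \<open>p\<close> divide \<open>\<psi>\<close> of the next iterate.
\<close>

lemma almost_all_iterates_keep_prime:
  assumes "prime p"
  shows "null_density {n. \<not> ((dedekind_T ^^ j) n > 0 \<and> (p dvd n \<longrightarrow> p dvd (dedekind_T ^^ j) n))}"
  using assms
proof (induction j arbitrary: p)
  case 0
  show ?case by (rule null_density_subset[OF null_density_empty]) auto
next
  case (Suc j)
  let ?bad = "\<lambda>q. {n. \<not> ((dedekind_T ^^ j) n > 0 \<and> (q dvd n \<longrightarrow> q dvd (dedekind_T ^^ j) n))}"
  show ?case
  proof (rule null_densityI)
    fix \<delta> :: real assume "\<delta> > 0"
    obtain S where S: "finite S" "\<And>q. q \<in> S \<Longrightarrow> prime q \<and> p dvd q + 1"
      "density_le {n. \<forall>q\<in>S. \<not> q dvd n} \<delta>"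
      using sieve_density[OF Suc.prems \<open>\<delta> > 0\<close>] by blast
    \<comment> \<open>The induction runs over all primes at once: the hypothesis is used for
      \<open>p\<close> and for each of the finitely many \<open>q\<close>.\<close>
    have "null_density (\<Union>q\<in>insert p S. ?bad q)"
      using S Suc by (intro null_density_UN) auto
    moreover have "{n. \<not> ((dedekind_T ^^ Suc j) n > 0 \<and> (p dvd n \<longrightarrow> p dvd (dedekind_T ^^ Suc j) n))}
        \<subseteq> (\<Union>q\<in>insert p S. ?bad q) \<union> {n. \<forall>q\<in>S. \<not> q dvd n}"
    proof (rule ccontr)
      assume "\<not> ?thesis"
      then obtain n where n: "\<not> ((dedekind_T ^^ Suc j) n > 0 \<and> (p dvd n \<longrightarrow> p dvd (dedekind_T ^^ Suc j) n))"
        "n \<notin> (\<Union>q\<in>insert p S. ?bad q)" "\<not> (\<forall>q\<in>S. \<not> q dvd n)" by blast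
      define m where "m = (dedekind_T ^^ j) n"
      obtain q where q: "q \<in> S" "q dvd n" using n(3) by blast
      have m: "m > 0" "q dvd m" "p dvd n \<Longrightarrow> p dvd m" using n(2) q by (auto simp: m_def)
      have "prime q" using S q by blast
      \<comment> \<open>The divisor \<open>q\<close> also keeps the orbit alive: among positive
        values only 1 is sent to 0.\<close>
      have "q \<le> m" using m by (intro dvd_imp_le)
      hence "m > 1" using prime_gt_1_nat[OF \<open>prime q\<close>] by linarith
      hence "dedekind_T m > 0" by (rule dedekind_T_pos)
      moreover have "p dvd dedekind_T m" if "p dvd n"
      proof -
        have "p dvd dedekind_T m + m"
          using S(2)[OF q(1)] prime_Suc_dvd_dedekind_psi[OF m(1) \<open>prime q\<close> m(2)] dvd_trans by blast
        thus ?thesis using m(3)[OF that] by (simp add: dvd_add_left_iff)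
      qed
      ultimately show False using n(1) by (simp add: m_def)
    qed
    ultimately show "\<exists>E' D. null_density E' \<and> density_le D \<delta> \<and>
        {n. \<not> ((dedekind_T ^^ Suc j) n > 0 \<and> (p dvd n \<longrightarrow> p dvd (dedekind_T ^^ Suc j) n))} \<subseteq> E' \<union> D"
      using S(3) by blast
  qed
qed

section \<open>Truncating the product over primes\<close>

definition divisor_tail :: "nat \<Rightarrow> nat \<Rightarrow> real" where
  "divisor_tail y n = (\<Sum>d | d dvd n. if d > y then 1 / real d else 0)"

text \<open>Expanding both products over sets of primes leaves the sets that contain some prime
  above \<open>y\<close>. Their products are distinct divisors of \<open>n\<close> exceeding
  \<open>y\<close>.\<close>

lemma prime_product_truncation:
  assumes "n > 0"
  shows "(\<Prod>p\<in>prime_factors n. 1 + 1 / real p) - (\<Prod>p | p \<in> prime_factors n \<and> p \<le> y. 1 + 1 / real p)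
           \<le> divisor_tail y n"
proof -
  let ?P = "prime_factors n"
  let ?Q = "{p. p \<in> prime_factors n \<and> p \<le> y}"
  have expand: "(\<Prod>p\<in>A. 1 + 1 / real p) = (\<Sum>B\<in>Pow A. 1 / real (\<Prod>B))" if "finite A" for A
  proof -
    have "(\<Prod>p\<in>A. 1 + 1 / real p) = (\<Prod>p\<in>A. 1 / real p + 1)" by (simp add: add.commute)
    also have "\<dots> = (\<Sum>B\<in>Pow A. (\<Prod>p\<in>B. 1 / real p) * (\<Prod>p\<in>A - B. 1))"
      using that by (rule prod_add)
    also have "\<dots> = (\<Sum>B\<in>Pow A. 1 / real (\<Prod>B))"
      by (simp add: prod_dividef)
    finally show ?thesis .
  qed
  have fin: "finite ?P" "finite ?Q" and sub: "Pow ?Q \<subseteq> Pow ?P" by auto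
  have "(\<Prod>p\<in>?P. 1 + 1 / real p) - (\<Prod>p\<in>?Q. 1 + 1 / real p) = (\<Sum>B\<in>Pow ?P - Pow ?Q. 1 / real (\<Prod>B))"
    unfolding expand[OF fin(1)] expand[OF fin(2)]
    by (rule sum_diff [symmetric]) (use fin sub in simp_all)
  also have "\<dots> = (\<Sum>d\<in>Prod ` (Pow ?P - Pow ?Q). 1 / real d)"
  proof (subst sum.reindex)
    show "inj_on Prod (Pow ?P - Pow ?Q)"
    proof (rule inj_onI)
      have pf: "prime_factors (\<Prod>B) = B" if "B \<subseteq> ?P" for B
      proof -
        have fin: "finite B" using that finite_subset by blast
        have "0 \<notin> B" using that by auto
        hence "prime_factors (\<Prod>B) = (\<Union>p\<in>B. prime_factors p)"
          using fin by (subst prime_factors_prod) auto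
        also have "\<dots> = (\<Union>p\<in>B. {p})"
        proof (intro SUP_cong refl)
          fix p assume "p \<in> B"
          hence "prime p" using that by (auto simp: in_prime_factors_iff)
          thus "prime_factors p = {p}" by (rule prime_prime_factors)
        qed
        also have "\<dots> = B" by simp
        finally show ?thesis .
      qed
      fix B C assume "B \<in> Pow ?P - Pow ?Q" "C \<in> Pow ?P - Pow ?Q" "\<Prod>B = \<Prod>C"
      thus "B = C" using pf[of B] pf[of C] by (metis Diff_iff PowD)
    qed
  qed simp
  also have "\<dots> \<le> divisor_tail y n"
  proof -
    have "Prod ` (Pow ?P - Pow ?Q) \<subseteq> {d. d dvd n \<and> d > y}"
    proof (rule image_subsetI)
      fix B assume "B \<in> Pow ?P - Pow ?Q"
      then obtain p where B: "B \<subseteq> ?P" "p \<in> B" "\<not> p \<le> y" by blast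
      have fin: "finite B" using B(1) finite_subset by blast
      have "\<Prod>B dvd \<Prod>?P" using B(1) by (intro prod_dvd_prod_subset) auto
      also have "\<Prod>?P dvd (\<Prod>p\<in>?P. p ^ multiplicity p n)"
        by (intro prod_dvd_prod) (auto simp: prime_factors_multiplicity intro!: dvd_power)
      also have "\<dots> = n" using assms by (simp add: prod_prime_factors)
      finally have dvd: "\<Prod>B dvd n" .
      have "p dvd \<Prod>B" using fin B(2) dvd_prodI[of B p "\<lambda>x. x"] by simp
      moreover have "\<Prod>B > 0" using dvd assms by (cases "\<Prod>B = 0") simp_all
      ultimately have "p \<le> \<Prod>B" by (rule dvd_imp_le)
      thus "\<Prod>B \<in> {d. d dvd n \<and> d > y}" using B(3) dvd by simp
    qed
    hence "(\<Sum>d\<in>Prod ` (Pow ?P - Pow ?Q). 1 / real d) \<le> (\<Sum>d | d dvd n \<and> d > y. 1 / real d)"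
      using assms by (intro sum_mono2) auto
    also have "\<dots> = divisor_tail y n"
      unfolding divisor_tail_def using assms by (subst sum.inter_filter [symmetric]) auto
    finally show ?thesis .
  qed
  finally show ?thesis .
qed

lemma sum_inverse_squares_tail:
  assumes "y > 0"
  shows "(\<Sum>d=Suc y..N. 1 / real d ^ 2) \<le> 1 / real y"
proof (cases "y \<le> N")
  case True
  hence "(\<Sum>d=Suc y..N. 1 / real d ^ 2) \<le> 1 / real y - 1 / real N"
  proof (induction N rule: dec_induct)
    case (step N)
    have "1 / real (Suc N) ^ 2 \<le> 1 / (real N * real (Suc N))"
      using step assms by (intro divide_left_mono) (auto simp: power2_eq_square intro!: mult_right_mono)
    also have "\<dots> = 1 / real N - 1 / real (Suc N)"
      using step assms by (simp add: field_simps)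
    finally show ?case using step by simp
  qed simp
  moreover have "1 / real N \<ge> 0" by simp
  ultimately show ?thesis by linarith
qed simp

text \<open>Since the tail runs over all divisors, its mean is at most the sum of
  \<open>1 / d ^ 2\<close> over \<open>d > y\<close>, which telescopes to at most
  \<open>1 / y\<close>.\<close>

lemma divisor_tail_average:
  assumes "y > 0"
  shows "(\<Sum>n=1..N. divisor_tail y n) \<le> real N / real y"
proof -
  have "(\<Sum>n=1..N. divisor_tail y n) = (\<Sum>d=1..N. \<Sum>m=1..N div d. if d > y then 1 / real d else 0)"
    unfolding divisor_tail_def by (rule sum_divisors_swap)
  also have "\<dots> = (\<Sum>d=1..N. if d > y then real (N div d) * (1 / real d) else 0)"
    by (intro sum.cong) auto
  also have "\<dots> = (\<Sum>d=Suc y..N. real (N div d) * (1 / real d))"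
    by (subst sum.inter_filter [symmetric]) (auto intro!: sum.cong)
  also have "\<dots> \<le> (\<Sum>d=Suc y..N. real N * (1 / real d ^ 2))"
  proof (rule sum_mono)
    fix d assume "d \<in> {Suc y..N}"
    have "real (N div d) * (1 / real d) \<le> real N / real d * (1 / real d)"
      by (intro mult_right_mono of_nat_div_le_of_nat) auto
    thus "real (N div d) * (1 / real d) \<le> real N * (1 / real d ^ 2)"
      by (simp add: power2_eq_square)
  qed
  also have "\<dots> = real N * (\<Sum>d=Suc y..N. 1 / real d ^ 2)" by (simp add: sum_distrib_left)
  also have "\<dots> \<le> real N * (1 / real y)"
    using assms by (intro mult_left_mono sum_inverse_squares_tail) auto
  finally show ?thesis by simp
qed

text \<open>Markov's inequality applied to the mean of \<open>divisor_tail\<close>.\<close>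

lemma divisor_tail_density:
  assumes "y > 0" "t > 0"
  shows "density_le {n. divisor_tail y n > t} (1 / (real y * t))"
  unfolding density_le_def
proof (intro exI allI impI)
  fix N :: nat
  have nn: "divisor_tail y n \<ge> 0" for n unfolding divisor_tail_def by (intro sum_nonneg) auto
  have "t * real (card ({1..N} \<inter> {n. divisor_tail y n > t})) = (\<Sum>n\<in>{1..N} \<inter> {n. divisor_tail y n > t}. t)"
    by simp
  also have "\<dots> \<le> (\<Sum>n\<in>{1..N} \<inter> {n. divisor_tail y n > t}. divisor_tail y n)"
    by (intro sum_mono) auto
  also have "\<dots> \<le> (\<Sum>n=1..N. divisor_tail y n)"
    by (intro sum_mono2 nn) auto
  also have "\<dots> \<le> real N / real y" using assms by (intro divisor_tail_average)
  finally show "real (card ({1..N} \<inter> {n. divisor_tail y n > t})) \<le> 1 / (real y * t) * real N"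
    using assms by (simp add: field_simps)
qed

section \<open>Ratios along the orbit\<close>

definition ratios_close :: "nat \<Rightarrow> real \<Rightarrow> nat \<Rightarrow> bool" where
  "ratios_close k \<epsilon> n \<longleftrightarrow> (\<forall>j<k. T_iterate_defined (j + 1) n \<and> (dedekind_T ^^ j) n \<noteq> 0 \<and>
     real ((dedekind_T ^^ (j + 1)) n) / real ((dedekind_T ^^ j) n)
       \<ge> (1 - \<epsilon>) * (real (dedekind_T n) / real n))"

lemma ratios_close_mono: "\<epsilon> \<le> \<epsilon>' \<Longrightarrow> ratios_close k \<epsilon> n \<Longrightarrow> ratios_close k \<epsilon>' n"
proof -
  assume "\<epsilon> \<le> \<epsilon>'" and close: "ratios_close k \<epsilon> n"
  hence "(1 - \<epsilon>') * (real (dedekind_T n) / real n) \<le> (1 - \<epsilon>) * (real (dedekind_T n) / real n)"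
    by (intro mult_right_mono) auto
  thus ?thesis using close unfolding ratios_close_def by (meson order.trans)
qed

lemma ratios_close_almost_all:
  assumes \<epsilon>: "\<epsilon> > 0"
  shows "null_density {n. \<not> ratios_close k \<epsilon> n}"
proof (rule null_densityI)
  fix \<delta> :: real assume \<delta>: "\<delta> > 0"
  let ?bad = "\<lambda>(j, p). {n. \<not> ((dedekind_T ^^ j) n > 0 \<and> (p dvd n \<longrightarrow> p dvd (dedekind_T ^^ j) n))}"
  \<comment> \<open>Taken for the prime 2, the sieve provides \<open>n\<close> with an odd prime
    factor from a fixed finite set; its maximum \<open>w\<close> gives
    \<open>T(n)/n \<ge> 1/w\<close>.\<close>
  obtain S where S: "finite S" "\<And>q. q \<in> S \<Longrightarrow> prime q \<and> 2 dvd q + 1"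
    "density_le {n. \<forall>q\<in>S. \<not> q dvd n} (\<delta> / 2)"
    using sieve_density[of 2 "\<delta> / 2"] \<delta> by auto
  define w where "w = Max (insert 1 S)"
  have w: "w \<ge> 1" "\<And>q. q \<in> S \<Longrightarrow> q \<le> w" using S(1) by (auto simp: w_def)
  \<comment> \<open>An additive error of at most \<open>t\<close> is a relative error of at most
    \<epsilon> once \<open>T(n)/n \<ge> 1/w\<close>.\<close>
  define t where "t = \<epsilon> / real w"
  have t: "t > 0" using \<epsilon> w by (simp add: t_def)
  obtain y :: nat where y: "real y > 2 / (\<delta> * t)" using reals_Archimedean2 by blast
  have "2 / (\<delta> * t) > 0" using \<delta> t by simp
  hence y0: "y > 0" using y by (cases "y = 0") auto
  have "1 / (real y * t) \<le> \<delta> / 2" using y \<delta> t y0 by (simp add: field_simps)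
  hence tail: "density_le {n. divisor_tail y n > t} (\<delta> / 2)"
    by (intro density_le_subset[OF divisor_tail_density[OF y0 t]]) auto
  define D where "D = {n. \<forall>q\<in>S. \<not> q dvd n} \<union> {n. divisor_tail y n > t}"
  have D: "density_le D \<delta>" using density_le_Un[OF S(3) tail] by (simp add: D_def)
  \<comment> \<open>The bound \<open>y + 2\<close> ensures that the prime 2 is present even for
    \<open>y = 1\<close>; positivity of the iterates is read off from it.\<close>
  define I where "I = {..k} \<times> {p. p \<le> y + 2 \<and> prime p}"
  have fin: "finite {p. p \<le> y + 2 \<and> prime p}" by (rule finite_subset[of _ "{..y + 2}"]) auto
  have null: "null_density (\<Union>i\<in>I. ?bad i)"
    using fin almost_all_iterates_keep_prime by (intro null_density_UN) (auto simp: I_def)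
  have "ratios_close k \<epsilon> n" if n: "n \<notin> (\<Union>i\<in>I. ?bad i)" "n \<notin> D" for n
  proof -
    have keep: "(dedekind_T ^^ j) n > 0 \<and> (p dvd n \<longrightarrow> p dvd (dedekind_T ^^ j) n)"
      if "j \<le> k" "p \<le> y + 2" "prime p" for j p
      using n(1) that by (force simp: I_def)
    have pos: "(dedekind_T ^^ j) n > 0" if "j \<le> k" for j
      using keep[OF that, of 2] by simp
    have n0: "n > 0" using pos[of 0] by simp
    let ?F = "real (dedekind_T n) / real n"
    obtain q where q: "q \<in> S" "q dvd n" using n(2) by (auto simp: D_def)
    have "prime q" using S(2) q by blast
    have "1 / real w \<le> 1 / real q"
      using w(2)[OF q(1)] prime_gt_0_nat[OF \<open>prime q\<close>] by (simp add: frac_le)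
    also have "\<dots> \<le> ?F" by (rule dedekind_T_ratio_ge[OF n0 \<open>prime q\<close> q(2)])
    finally have "\<epsilon> * (1 / real w) \<le> \<epsilon> * ?F" using \<epsilon> by (intro mult_left_mono) auto
    hence "divisor_tail y n \<le> \<epsilon> * ?F" using n(2) by (simp add: D_def t_def)
    moreover have "(1 - \<epsilon>) * ?F = ?F - \<epsilon> * ?F" by (simp only: left_diff_distrib mult_1_left)
    ultimately have trunc: "(\<Prod>p | p \<in> prime_factors n \<and> p \<le> y. 1 + 1 / real p) - 1 \<ge> (1 - \<epsilon>) * ?F"
      using prime_product_truncation[OF n0, of y] dedekind_T_ratio[OF n0] by linarith
    show ?thesis
      unfolding ratios_close_def
    proof (intro allI impI conjI)
      fix j assume j: "j < k"
      define m where "m = (dedekind_T ^^ j) n"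
      have m: "m > 0" using pos j by (simp add: m_def)
      show "T_iterate_defined (j + 1) n" using pos j by (simp add: T_iterate_defined_def)
      show "(dedekind_T ^^ j) n \<noteq> 0" using m by (simp add: m_def)
      have "(\<Prod>p | p \<in> prime_factors n \<and> p \<le> y. 1 + 1 / real p) \<le> (\<Prod>p\<in>prime_factors m. 1 + 1 / real p)"
      proof (rule prod_mono2)
        show "{p. p \<in> prime_factors n \<and> p \<le> y} \<subseteq> prime_factors m"
          using keep[of j] j m by (auto simp: in_prime_factors_iff m_def)
      qed auto
      thus "(1 - \<epsilon>) * ?F \<le> real ((dedekind_T ^^ (j + 1)) n) / real ((dedekind_T ^^ j) n)"
        using trunc dedekind_T_ratio[OF m] by (simp add: m_def)
    qed
  qed
  hence "{n. \<not> ratios_close k \<epsilon> n} \<subseteq> (\<Union>i\<in>I. ?bad i) \<union> D" by blast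
  thus "\<exists>E' D. null_density E' \<and> density_le D \<delta> \<and> {n. \<not> ratios_close k \<epsilon> n} \<subseteq> E' \<union> D"
    using null D by blast
qed

definition iterate_large :: "nat \<Rightarrow> real \<Rightarrow> nat \<Rightarrow> bool" where
  "iterate_large j \<epsilon> n \<longleftrightarrow> T_iterate_defined j n \<and>
     real ((dedekind_T ^^ j) n) \<ge> (1 - \<epsilon>) * real n * (real (dedekind_T n) / real n) ^ j"

lemma iterate_large_mono: "\<epsilon> \<le> \<epsilon>' \<Longrightarrow> iterate_large j \<epsilon> n \<Longrightarrow> iterate_large j \<epsilon>' n"
proof -
  assume "\<epsilon> \<le> \<epsilon>'" and large: "iterate_large j \<epsilon> n"
  hence "(1 - \<epsilon>') * real n * (real (dedekind_T n) / real n) ^ j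
      \<le> (1 - \<epsilon>) * real n * (real (dedekind_T n) / real n) ^ j"
    by (intro mult_right_mono) auto
  thus ?thesis using large unfolding iterate_large_def by linarith
qed

text \<open>Multiplying the \<open>j\<close> ratios gives the factor
  \<open>(1 - \<epsilon>) ^ j\<close>, which is at least \<open>1 - j * \<epsilon>\<close> by
  Bernoulli. The condition \<open>\<epsilon> \<le> 1\<close> keeps the multiplied lower bounds
  non-negative.\<close>

lemma ratios_close_imp_iterate_large:
  assumes close: "ratios_close j \<epsilon> n" and \<epsilon>: "\<epsilon> \<le> 1" and j: "j > 0"
  shows "iterate_large j (real j * \<epsilon>) n"
proof -
  define F where "F = real (dedekind_T n) / real n"
  have ratio: "real ((dedekind_T ^^ Suc i) n) \<ge> (1 - \<epsilon>) * F * real ((dedekind_T ^^ i) n)" if "i < j" for i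
  proof -
    have "(1 - \<epsilon>) * F \<le> real ((dedekind_T ^^ (i + 1)) n) / real ((dedekind_T ^^ i) n)"
      "(dedekind_T ^^ i) n \<noteq> 0"
      using close that unfolding ratios_close_def F_def by blast+
    thus ?thesis by (simp only: pos_le_divide_eq of_nat_0_less_iff neq0_conv Suc_eq_plus1)
  qed
  have nn: "(1 - \<epsilon>) * F \<ge> 0" using \<epsilon> by (simp add: F_def)
  have "real ((dedekind_T ^^ i) n) \<ge> real n * ((1 - \<epsilon>) * F) ^ i" if "i \<le> j" for i
    using that
  proof (induction i)
    case (Suc i)
    have "real n * ((1 - \<epsilon>) * F) ^ Suc i = (1 - \<epsilon>) * F * (real n * ((1 - \<epsilon>) * F) ^ i)"
      by (simp add: mult_ac)
    also have "\<dots> \<le> (1 - \<epsilon>) * F * real ((dedekind_T ^^ i) n)"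
      using Suc nn by (intro mult_left_mono) auto
    also have "\<dots> \<le> real ((dedekind_T ^^ Suc i) n)" using ratio Suc.prems by simp
    finally show ?case .
  qed simp
  from this[of j] have "real ((dedekind_T ^^ j) n) \<ge> (1 - \<epsilon>) ^ j * real n * F ^ j"
    by (simp add: power_mult_distrib mult_ac)
  moreover have "(1 - real j * \<epsilon>) * real n * F ^ j \<le> (1 - \<epsilon>) ^ j * real n * F ^ j"
    using Bernoulli_inequality[of "- \<epsilon>" j] \<epsilon> by (intro mult_right_mono) (auto simp: F_def)
  moreover have "T_iterate_defined j n"
  proof -
    have "j - 1 < j" using j by simp
    hence "T_iterate_defined (j - 1 + 1) n" using close unfolding ratios_close_def by blast
    thus ?thesis using j by simp
  qed
  ultimately show ?thesis unfolding iterate_large_def F_def by linarith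
qed

lemma iterate_large_almost_all:
  assumes "\<epsilon> > 0" "j > 0"
  shows "null_density {n. \<not> iterate_large j \<epsilon> n}"
proof -
  define \<epsilon>' where "\<epsilon>' = min 1 (\<epsilon> / real j)"
  have \<epsilon>': "\<epsilon>' > 0" "\<epsilon>' \<le> 1" "real j * \<epsilon>' \<le> \<epsilon>"
    using assms by (auto simp: \<epsilon>'_def min_def field_simps)
  have "iterate_large j \<epsilon> n" if "ratios_close j \<epsilon>' n" for n
    using iterate_large_mono[OF \<epsilon>'(3)] ratios_close_imp_iterate_large[OF that \<epsilon>'(2) assms(2)] by blast
  thus ?thesis
    by (intro null_density_subset[OF ratios_close_almost_all[OF \<epsilon>'(1), of j]]) auto
qed

theorem theorem2:
  shows "(\<forall>k::nat. k > 0 \<longrightarrow>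
           (\<exists>(A :: nat set) (\<xi> :: nat \<Rightarrow> real).
              A \<subseteq> {n. n > 0} \<and> has_asymptotic_density A 1 \<and>
              (\<xi> \<longlongrightarrow> 0) (inf at_top (principal A)) \<and>
              (\<forall>n\<in>A. \<forall>j<k.
                 T_iterate_defined (j + 1) n \<and> (dedekind_T ^^ j) n \<noteq> 0 \<and>
                 real ((dedekind_T ^^ (j + 1)) n) / real ((dedekind_T ^^ j) n)
                   \<ge> (1 - \<xi> n) * (real (dedekind_T n) / real n)))) \<and>
         (\<forall>j::nat. j > 0 \<longrightarrow>
           (\<exists>(A :: nat set) (\<xi> :: nat \<Rightarrow> real).
              A \<subseteq> {n. n > 0} \<and> has_asymptotic_density A 1 \<and>
              (\<xi> \<longlongrightarrow> 0) (inf at_top (principal A)) \<and>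
              (\<forall>n\<in>A.
                 T_iterate_defined j n \<and>
                 real ((dedekind_T ^^ j) n)
                   \<ge> (1 - \<xi> n) * real n * (real (dedekind_T n) / real n) ^ j)))"
proof (intro conjI allI impI)
  fix k :: nat
  have "\<exists>A \<xi>. A \<subseteq> {n. n > 0} \<and> has_asymptotic_density A 1 \<and>
      (\<xi> \<longlongrightarrow> 0) (inf at_top (principal A)) \<and> (\<forall>n\<in>A. ratios_close k (\<xi> n) n)"
    by (rule almost_all_diagonal[where Q = "ratios_close k"])
      (fact ratios_close_almost_all, fact ratios_close_mono)
  thus "\<exists>(A :: nat set) (\<xi> :: nat \<Rightarrow> real).
      A \<subseteq> {n. n > 0} \<and> has_asymptotic_density A 1 \<and>
      (\<xi> \<longlongrightarrow> 0) (inf at_top (principal A)) \<and>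
      (\<forall>n\<in>A. \<forall>j<k.
         T_iterate_defined (j + 1) n \<and> (dedekind_T ^^ j) n \<noteq> 0 \<and>
         real ((dedekind_T ^^ (j + 1)) n) / real ((dedekind_T ^^ j) n)
           \<ge> (1 - \<xi> n) * (real (dedekind_T n) / real n))"
    unfolding ratios_close_def .
next
  fix j :: nat assume "j > 0"
  hence "\<exists>A \<xi>. A \<subseteq> {n. n > 0} \<and> has_asymptotic_density A 1 \<and>
      (\<xi> \<longlongrightarrow> 0) (inf at_top (principal A)) \<and> (\<forall>n\<in>A. iterate_large j (\<xi> n) n)"
    by (intro almost_all_diagonal[where Q = "iterate_large j"] iterate_large_almost_all)
      (assumption | erule iterate_large_mono)+
  thus "\<exists>(A :: nat set) (\<xi> :: nat \<Rightarrow> real).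
      A \<subseteq> {n. n > 0} \<and> has_asymptotic_density A 1 \<and>
      (\<xi> \<longlongrightarrow> 0) (inf at_top (principal A)) \<and>
      (\<forall>n\<in>A.
         T_iterate_defined j n \<and>
         real ((dedekind_T ^^ j) n) \<ge> (1 - \<xi> n) * real n * (real (dedekind_T n) / real n) ^ j)"
    unfolding iterate_large_def .
qed

end
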